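(* Let $\mathbb{F}_q$ be a finite field with $q\equiv 1\pmod 3$, let $b_0\in\mathbb{F}_q$ be such that $\chi(b_0)=\rho$, and let $t\in\mathbb{F}_q$ be a non quadratic residue. There exist $(2q+4)/3$ isomorphism classes of elliptic curves over $\mathbb{F}_q$ with only one rational subgroup of order three, whose points are defined over $\mathbb{F}_{q^2}\setminus\mathbb{F}_q$. A family of representatives is given by the curves $y^2=x^3+t^2A_a\,x+t^3B_a$ with $$A_a=-\frac{a^3(a^9-24b_0^i)}{48},\qquad B_a=\frac{b_0^{2i}}{4}+\frac{a^{18}}{864}-\frac{a^9b_0^i}{24},$$ where $i=0,1,2$ and $\chi(a^3-27b_0^i)\neq 1$.
   Context: Here $\chi$ is a cubic character over $\mathbb{F}_q$ and $\rho$ is a primitive cube root of unity, so that $\chi(b_0)=\rho$ means in particular that $b_0$ is not a cube; the parameter $a$ ranges over elements of $\mathbb{F}_q$. A subgroup of the group of points of an elliptic curve $E$ over the algebraic closure of $\mathbb{F}_q$ is called rational if it is stable, as a set, under the Frobenius map $(x,y)\mapsto(x^q,y^q)$; its individual points need not be defined over $\mathbb{F}_q$. The statement about the points of the subgroup refers to its points other than the point at infinity. Isomorphism classes are over $\mathbb{F}_q$.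
   Formalization: The printed family misses classes (q=19: at most 9 of 14), so a^3 is replaced by a: A_a=-a(a^3-24b_0^i)/48, B_a=b_0^{2i}/4+a^6/864-a^3b_0^i/24; singular members (i=0, a^3=27) are excluded; (i,a), (j,c) give the same class iff i=j and a^3=c^3. *)

theory Defs
  imports Complex_Main "HOL-Library.Cardinality" "HOL-Algebra.Algebraic_Closure_Type"
begin

text \<open>
  \<open>Weierstrass a1 a2 a3 a4 a6\<close> stands for
  $y^2 + a_1 xy + a_3 y = x^3 + a_2 x^2 + a_4 x + a_6$.
\<close>

datatype 'k weierstrass = Weierstrass 'k 'k 'k 'k 'k

fun discriminant :: "'k::field weierstrass \<Rightarrow> 'k" where
  "discriminant (Weierstrass a1 a2 a3 a4 a6) =
    (let b2 = a1^2 + 4 * a2;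
         b4 = 2 * a4 + a1 * a3;
         b6 = a3^2 + 4 * a6;
         b8 = a1^2 * a6 + 4 * a2 * a6 - a1 * a3 * a4 + a2 * a3^2 - a4^2
     in - (b2^2 * b8) - 8 * b4^3 - 27 * b6^2 + 9 * b2 * b4 * b6)"

definition elliptic_curve :: "'k::field weierstrass \<Rightarrow> bool" where
  "elliptic_curve E \<longleftrightarrow> discriminant E \<noteq> 0"

text \<open>
  The curve \<open>E'\<close> is \<open>E\<close> after the substitution
  $x = u^2 x' + r$, $y = u^3 y' + u^2 s x' + w$ and division by $u^6$.
\<close>

fun change_of_variables :: "'k::field \<Rightarrow> 'k \<Rightarrow> 'k \<Rightarrow> 'k \<Rightarrow>
    'k weierstrass \<Rightarrow> 'k weierstrass \<Rightarrow> bool" where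
  "change_of_variables u r s w (Weierstrass a1 a2 a3 a4 a6) (Weierstrass c1 c2 c3 c4 c6) \<longleftrightarrow>
     u * c1 = a1 + 2 * s \<and>
     u^2 * c2 = a2 - s * a1 + 3 * r - s^2 \<and>
     u^3 * c3 = a3 + r * a1 + 2 * w \<and>
     u^4 * c4 = a4 - s * a3 + 2 * r * a2 - (w + r * s) * a1 + 3 * r^2 - 2 * s * w \<and>
     u^6 * c6 = a6 + r * a4 + r^2 * a2 + r^3 - w * a3 - w^2 - r * w * a1"

definition curve_isomorphism :: "('k::field weierstrass \<times> 'k weierstrass) set" where
  "curve_isomorphism = {(E, E'). elliptic_curve E \<and> elliptic_curve E' \<and>
     (\<exists>u r s w. u \<noteq> 0 \<and> change_of_variables u r s w E E')}"

datatype 'k point = Infinity | Affine 'k 'k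

fun on_curve :: "'k::field weierstrass \<Rightarrow> 'k point \<Rightarrow> bool" where
  "on_curve E Infinity \<longleftrightarrow> True"
| "on_curve (Weierstrass a1 a2 a3 a4 a6) (Affine x y) \<longleftrightarrow>
     y^2 + a1 * x * y + a3 * y = x^3 + a2 * x^2 + a4 * x + a6"

text \<open>
  Chord and tangent law: \<open>y = l * x + n\<close> is the line through the two points
  (the tangent line, if they coincide).
\<close>

fun point_add :: "'k::field weierstrass \<Rightarrow> 'k point \<Rightarrow> 'k point \<Rightarrow> 'k point" where
  "point_add E Infinity Q = Q"
| "point_add E P Infinity = P"
| "point_add (Weierstrass a1 a2 a3 a4 a6) (Affine x1 y1) (Affine x2 y2) =
    (if x1 = x2 \<and> y1 + y2 + a1 * x2 + a3 = 0 then Infinity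
     else
       let l = (if x1 = x2
                then (3 * x1^2 + 2 * a2 * x1 + a4 - a1 * y1) / (2 * y1 + a1 * x1 + a3)
                else (y2 - y1) / (x2 - x1));
           n = y1 - l * x1;
           x3 = l^2 + a1 * l - a2 - x1 - x2
       in Affine x3 (- (l + a1) * x3 - n - a3))"

definition point_group :: "'k::field weierstrass \<Rightarrow> 'k point monoid" where
  "point_group E = \<lparr>carrier = {P. on_curve E P}, monoid.mult = point_add E, one = Infinity\<rparr>"

abbreviation geometric_point_group ::
    "'a::field weierstrass \<Rightarrow> 'a alg_closure point monoid" where
  "geometric_point_group E \<equiv> point_group (map_weierstrass to_ac E)"

definition frobenius :: "'a::{field,finite} alg_closure point \<Rightarrow> 'a alg_closure point" where
  "frobenius = map_point (\<lambda>x. x ^ CARD('a))"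

definition rational_subgroup ::
    "'a::{field,finite} weierstrass \<Rightarrow> 'a alg_closure point set \<Rightarrow> bool" where
  "rational_subgroup E H \<longleftrightarrow> subgroup H (geometric_point_group E) \<and> frobenius ` H = H"

definition base_field :: "'a::{field,finite} alg_closure set" where
  "base_field = range to_ac"

text \<open>
  The unique subfield of order $q^2$ of the algebraic closure of $\mathbf{F}_q$, $q$ being the
  cardinality of \<open>'a\<close>.
\<close>

definition quadratic_extension :: "'a::{field,finite} alg_closure set" where
  "quadratic_extension = {x. x ^ (CARD('a)^2) = x}"

definition defined_over :: "'k set \<Rightarrow> 'k point \<Rightarrow> bool" where
  "defined_over K P \<longleftrightarrow> set_point P \<subseteq> K"

definition only_one_rational_3_subgroup_quadratic :: "'a::{field,finite} weierstrass \<Rightarrow> bool" where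
  "only_one_rational_3_subgroup_quadratic E \<longleftrightarrow>
     (\<exists>H. {H'. rational_subgroup E H' \<and> card H' = 3} = {H} \<and>
          (\<forall>P\<in>H. P \<noteq> Infinity \<longrightarrow>
             defined_over quadratic_extension P \<and> \<not> defined_over base_field P))"

definition special_curves :: "'a::{field,finite} weierstrass set" where
  "special_curves = {E. elliptic_curve E \<and> only_one_rational_3_subgroup_quadratic E}"

text \<open>A multiplicative character of order three, extended by zero as usual.\<close>

definition cubic_character :: "('a::field \<Rightarrow> complex) \<Rightarrow> bool" where
  "cubic_character \<chi> \<longleftrightarrow> \<chi> 0 = 0 \<and> (\<forall>x y. \<chi> (x * y) = \<chi> x * \<chi> y) \<and>
     (\<forall>x. x \<noteq> 0 \<longrightarrow> \<chi> x ^ 3 = 1) \<and> (\<exists>x. x \<noteq> 0 \<and> \<chi> x \<noteq> 1)"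

text \<open>
  In characteristic different from 2 and 3, \<open>y^2 = x^3 + coeff_A a b * x + coeff_B a b\<close> is the
  short form of \<open>y^2 + a x y + b y = x^3\<close>, whose discriminant is \<open>b^3 (a^3 - 27 b)\<close> and for which
  \<open>(0, 0)\<close> is a point of order three; the representatives are the twists of these curves by a
  nonsquare \<open>t\<close>. The source prints \<open>a^3\<close> for \<open>a\<close> in both coefficients, while keeping the condition
  on \<open>a^3 - 27 b\<close>. That is a misprint: with these coefficients the family misses classes, for
  example over the field with 19 elements.
\<close>

definition coeff_A :: "'a::field \<Rightarrow> 'a \<Rightarrow> 'a" where
  "coeff_A a b = - (a * (a^3 - 24 * b)) / 48"

definition coeff_B :: "'a::field \<Rightarrow> 'a \<Rightarrow> 'a" where
  "coeff_B a b = b^2 / 4 + a^6 / 864 - a^3 * b / 24"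

definition representative :: "'a::field \<Rightarrow> 'a \<Rightarrow> nat \<Rightarrow> 'a \<Rightarrow> 'a weierstrass" where
  "representative b0 t i a =
     Weierstrass 0 0 0 (t^2 * coeff_A a (b0^i)) (t^3 * coeff_B a (b0^i))"

text \<open>
  The requirement \<open>elliptic_curve\<close> only removes the singular cubics with \<open>a^3 = 27\<close> and \<open>i = 0\<close>,
  for which the character takes the value 0.
\<close>

definition representative_indices ::
    "('a::field \<Rightarrow> complex) \<Rightarrow> 'a \<Rightarrow> 'a \<Rightarrow> (nat \<times> 'a) set" where
  "representative_indices \<chi> b0 t =
     {(i, a). i \<in> {0, 1, 2} \<and> \<chi> (a^3 - 27 * b0^i) \<noteq> 1 \<and> elliptic_curve (representative b0 t i a)}"

end

theory Submission
  imports Defs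
begin

text \<open>
  The subgroups of order three of a nonsingular cubic are the sets consisting of the point at
  infinity and the two points over a root of the three-division polynomial; such a subgroup is
  rational iff the root lies in the base field, and its points are then defined over the quadratic
  extension, and outside the base field iff the two-division polynomial takes a nonsquare value at
  the root. Moving the root to \<open>x = 0\<close> brings the curve into the form
  $y^2 = x^3 + t (a x + t b)^2 / 4$, and the remaining roots of the three-division polynomial in the
  base field correspond to cube roots of $a^3 - 27 b$. Scaling by $u$ replaces $(a, b)$ by
  $(a / u, b / u^3)$, so $b$ can be taken among $1, b_0, b_0^2$. For $a \neq 0$ the pair
  $(b_0^i, a^3)$ is determined by $1 - 27 b_0^i / a^3$, which runs over the non-cubes;
  $a = 0$ contributes two more classes.
\<close>

section \<open>Subgroups of order three\<close>

text \<open>The group law enters through explicit formulas for negation, for doubling and for the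
  sum of two points of order two. The delicate case for three-element subgroups is two distinct
  points of order two, and there nonsingularity decides. One observation organises the computations.
  Let \<open>f\<close> be the two-division polynomial. Then \<open>f''/2\<close>,
  \<open>f'/2\<close>, \<open>f\<close> and the three-division polynomial, taken at
  \<open>x\<close>, are the invariants b2, b4, b6, b8 of the curve translated so that
  \<open>x\<close> becomes 0. The relation 4 b8 = b2 b6 - b4^2 therefore reads b2 b6 = b4^2 at a
  root of the three-division polynomial. This is the reason that the quadratic added to
  \<open>x^3\<close> in the normal form is a constant times a perfect square. The data also fix the
  characteristic: a nonsquare \<open>t\<close> excludes 2, and a noncube \<open>b0\<close> excludes
  3. The count is 2 (q - 1) / 3 noncubes plus the two classes with \<open>a = 0\<close>.\<close>

lemma four_nonzero:
  assumes "(2::'k::field) \<noteq> 0"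
  shows "(4::'k) \<noteq> 0"
proof -
  have "(4::'k) = 2 * 2" by simp
  then show ?thesis using assms by (metis mult_eq_0_iff)
qed

text \<open>This is the discriminant of the curve equation read as a quadratic in \<open>y\<close>;
  at a point of the curve it is the square of \<open>2 * y + a1 * x + a3\<close>.\<close>

fun two_division :: "'k::field weierstrass \<Rightarrow> 'k \<Rightarrow> 'k" where
  "two_division (Weierstrass a1 a2 a3 a4 a6) x = (a1 * x + a3)^2 + 4 * (x^3 + a2 * x^2 + a4 * x + a6)"

fun three_division :: "'k::field weierstrass \<Rightarrow> 'k \<Rightarrow> 'k" where
  "three_division (Weierstrass a1 a2 a3 a4 a6) x =
     3 * x^4 + (a1^2 + 4 * a2) * x^3 + 3 * (2 * a4 + a1 * a3) * x^2 + 3 * (a3^2 + 4 * a6) * x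
     + (a1^2 * a6 + 4 * a2 * a6 - a1 * a3 * a4 + a2 * a3^2 - a4^2)"

text \<open>Half of the first and half of the second derivative of the two-division polynomial.\<close>

fun two_division_d1 :: "'k::field weierstrass \<Rightarrow> 'k \<Rightarrow> 'k" where
  "two_division_d1 (Weierstrass a1 a2 a3 a4 a6) x =
     6 * x^2 + (a1^2 + 4 * a2) * x + (2 * a4 + a1 * a3)"

fun two_division_d2 :: "'k::field weierstrass \<Rightarrow> 'k \<Rightarrow> 'k" where
  "two_division_d2 (Weierstrass a1 a2 a3 a4 a6) x = 12 * x + a1^2 + 4 * a2"

fun point_neg :: "'k::field weierstrass \<Rightarrow> 'k point \<Rightarrow> 'k point" where
  "point_neg E Infinity = Infinity"
| "point_neg (Weierstrass a1 a2 a3 a4 a6) (Affine x y) = Affine x (- y - a1 * x - a3)"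

text \<open>Infinity belongs to every fiber, so that over a root of the three-division polynomial
  the fiber is itself the subgroup.\<close>

definition fiber :: "'k::field weierstrass \<Rightarrow> 'k \<Rightarrow> 'k point set" where
  "fiber E x = {P. on_curve E P \<and> (P = Infinity \<or> (\<exists>y. P = Affine x y))}"

lemma four_three_division:
  "4 * three_division E x = two_division_d2 E x * two_division E x - (two_division_d1 E x)^2"
  by (cases E) (simp add: algebra_simps power2_eq_square power3_eq_cube power4_eq_xxxx)

text \<open>Translating the curve by \<open>x\<close> leaves the discriminant unchanged and turns
  b2, b4, b8, b6 into the values at \<open>x\<close> of the four polynomials.\<close>

lemma discriminant_shift:
  "discriminant E = - ((two_division_d2 E x)^2 * three_division E x) - 8 * (two_division_d1 E x)^3
     - 27 * (two_division E x)^2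
     + 9 * two_division_d2 E x * two_division_d1 E x * two_division E x"
  by (cases E) (simp add: Let_def algebra_simps power2_eq_square power3_eq_cube power4_eq_xxxx)

text \<open>If b4 and b6 of the translated curve vanish, then 4 b8 = b2 b6 - b4^2 makes b8 vanish
  too, and every term of the discriminant contains one of these three.\<close>

lemma double_root_imp_singular:
  fixes E :: "'k::field weierstrass"
  assumes "(2::'k) \<noteq> 0" "two_division E x = 0" "two_division_d1 E x = 0"
  shows "discriminant E = 0"
proof -
  have "three_division E x = 0"
    using four_three_division[of E x] four_nonzero[OF assms(1)] assms by simp
  then show ?thesis using discriminant_shift[of E x] assms by simp
qed

text \<open>A common root of both division polynomials would be a double root of the two-division
  polynomial. Hence points of order three are never their own negatives.\<close>

lemma two_division_nonzero:
  fixes E :: "'k::field weierstrass"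
  assumes "(2::'k) \<noteq> 0" "elliptic_curve E" "three_division E x = 0"
  shows "two_division E x \<noteq> 0"
proof
  assume "two_division E x = 0"
  then show False using four_three_division[of E x] double_root_imp_singular[of E x] assms
    by (auto simp: elliptic_curve_def)
qed

lemma on_curve_point_neg: "on_curve E P \<Longrightarrow> on_curve E (point_neg E P)"
  by (cases E; cases P) (auto simp: algebra_simps power2_eq_square)

lemma two_division_on_curve:
  "on_curve (Weierstrass a1 a2 a3 a4 a6) (Affine x y) \<Longrightarrow>
     two_division (Weierstrass a1 a2 a3 a4 a6) x = (2 * y + a1 * x + a3)^2"
  by simp Groebner_Basis.algebra

lemma point_neg_eq_iff:
  fixes E :: "'k::field weierstrass"
  assumes "on_curve E (Affine x y)"
  shows "point_neg E (Affine x y) = Affine x y \<longleftrightarrow> two_division E x = 0"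
proof (cases E)
  case (Weierstrass a1 a2 a3 a4 a6)
  have "point_neg E (Affine x y) = Affine x y \<longleftrightarrow> 2 * y + a1 * x + a3 = 0"
    unfolding Weierstrass by simp Groebner_Basis.algebra
  moreover have "two_division E x = (2 * y + a1 * x + a3)^2"
    using two_division_on_curve assms unfolding Weierstrass by blast
  ultimately show ?thesis by simp
qed

lemma point_add_eq_Infinity_iff:
  "point_add E P Q = Infinity \<longleftrightarrow> Q = point_neg E P"
proof (cases "P = Infinity \<or> Q = Infinity")
  case True
  then show ?thesis by (cases E; cases P; cases Q) auto
next
  case False
  obtain a1 a2 a3 a4 a6 where E: "E = Weierstrass a1 a2 a3 a4 a6" by (cases E)
  obtain x1 y1 x2 y2 where PQ: "P = Affine x1 y1" "Q = Affine x2 y2"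
    using False by (cases P; cases Q) auto
  have "point_add E P Q = Infinity \<longleftrightarrow> x1 = x2 \<and> y1 + y2 + a1 * x2 + a3 = 0"
    unfolding E PQ by (simp add: Let_def)
  also have "\<dots> \<longleftrightarrow> x2 = x1 \<and> y2 = - y1 - a1 * x1 - a3"
    by (auto simp: algebra_simps eq_neg_iff_add_eq_0)
  finally show ?thesis unfolding E PQ by simp
qed

lemma point_neg_point_neg [simp]: "point_neg E (point_neg E P) = P"
  by (cases E; cases P) auto

text \<open>The inverse is a definite description over the carrier. Its uniqueness is read off the
  chord and tangent formulas: a sum is infinity for exactly one second summand.\<close>

lemma inv_point_group:
  assumes "on_curve E P"
  shows "inv\<^bsub>point_group E\<^esub> P = point_neg E P"
proof -
  have "(THE Q. on_curve E Q \<and> point_add E P Q = Infinity \<and> point_add E Q P = Infinity) = point_neg E P"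
  proof (rule the_equality)
    show "on_curve E (point_neg E P) \<and> point_add E P (point_neg E P) = Infinity \<and>
        point_add E (point_neg E P) P = Infinity"
      by (simp add: on_curve_point_neg[OF assms] point_add_eq_Infinity_iff)
  next
    fix Q
    assume "on_curve E Q \<and> point_add E P Q = Infinity \<and> point_add E Q P = Infinity"
    then have "point_add E P Q = Infinity" by blast
    then show "Q = point_neg E P" by (rule point_add_eq_Infinity_iff[THEN iffD1])
  qed
  then show ?thesis by (simp add: m_inv_def point_group_def)
qed

lemma fiber_eq:
  assumes "on_curve E (Affine x y)"
  shows "fiber E x = {Infinity, Affine x y, point_neg E (Affine x y)}"
proof (cases E)
  case (Weierstrass a1 a2 a3 a4 a6)
  have neg: "point_neg E (Affine x y) = Affine x (- y - a1 * x - a3)" by (simp add: Weierstrass)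
  have "y' = y \<or> y' = - y - a1 * x - a3" if "on_curve E (Affine x y')" for y'
  proof -
    \<comment> \<open>Both ordinates solve the same monic quadratic, whose roots add up to
      \<open>- a1 * x - a3\<close>.\<close>
    have "(y' - y) * (y' - (- y - a1 * x - a3)) = 0"
      using assms that unfolding Weierstrass by simp Groebner_Basis.algebra
    then show ?thesis by auto
  qed
  then show ?thesis
    using assms on_curve_point_neg[OF assms] unfolding fiber_def neg by auto
qed

text \<open>Doubling changes the abscissa by \<open>- three_division E x / D^2\<close>, where
  \<open>D = 2 * y + a1 * x + a3\<close> is nonzero because \<open>D^2\<close> is the two-division
  value. The first claim is stated for the abscissa alone, since closure of a three-element set
  yields just that.\<close>

lemma point_add_self:
  fixes E :: "'k::field weierstrass"
  assumes "(2::'k) \<noteq> 0" "on_curve E (Affine x y)" "two_division E x \<noteq> 0"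
  shows "(\<exists>y'. point_add E (Affine x y) (Affine x y) = Affine x y') \<longleftrightarrow> three_division E x = 0"
    and "three_division E x = 0 \<Longrightarrow>
      point_add E (Affine x y) (Affine x y) = point_neg E (Affine x y)"
proof -
  obtain a1 a2 a3 a4 a6 where E: "E = Weierstrass a1 a2 a3 a4 a6" by (cases E)
  define D where "D = 2 * y + a1 * x + a3"
  define N where "N = 3 * x^2 + 2 * a2 * x + a4 - a1 * y"
  have four: "(4::'k) \<noteq> 0" by (rule four_nonzero[OF assms(1)])
  have g: "two_division E x = D^2" using two_division_on_curve assms(2) by (simp add: E D_def)
  then have D: "D \<noteq> 0" using assms(3) by auto
  have "two_division_d1 E x = 2 * N + a1 * D"
    unfolding E D_def N_def by simp Groebner_Basis.algebra
  then have "4 * three_division E x = two_division_d2 E x * D^2 - (2 * N + a1 * D)^2"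
    by (simp add: four_three_division g)
  also have "\<dots> = 4 * (- (N^2 + a1 * N * D - (a2 + 3 * x) * D^2))"
    unfolding E two_division_d2.simps by Groebner_Basis.algebra
  finally have psi: "three_division E x = - (N^2 + a1 * N * D - (a2 + 3 * x) * D^2)"
    using four by (simp only: mult_cancel_left) simp
  let ?l = "N / D"
  let ?x = "?l^2 + a1 * ?l - a2 - x - x"
  have add: "point_add E (Affine x y) (Affine x y) = Affine ?x (- (?l + a1) * ?x - (y - ?l * x) - a3)"
  proof -
    have "y + y + a1 * x + a3 \<noteq> 0" using D unfolding D_def mult_2 .
    then show ?thesis unfolding E D_def N_def by (simp add: Let_def)
  qed
  have "?x - x = - three_division E x / D^2"
    unfolding psi using D by (simp add: field_simps power2_eq_square)
  then have x: "?x = x \<longleftrightarrow> three_division E x = 0" using D by auto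
  then show "(\<exists>y'. point_add E (Affine x y) (Affine x y) = Affine x y') \<longleftrightarrow> three_division E x = 0"
    unfolding add by auto
  show "point_add E (Affine x y) (Affine x y) = point_neg E (Affine x y)" if "three_division E x = 0"
  proof -
    have "?x = x" using x that by simp
    then show ?thesis unfolding add by (simp only: E point_neg.simps) (simp add: algebra_simps)
  qed
qed

text \<open>Both points lie on the line \<open>2 * y = - a1 * x - a3\<close>, so the third
  intersection has the third root of the two-division polynomial as abscissa. If it coincided with
  \<open>x1\<close> or \<open>x2\<close>, that polynomial would have a double root.\<close>

lemma point_add_two_torsion:
  fixes E :: "'k::field weierstrass"
  assumes two: "(2::'k) \<noteq> 0" and ell: "elliptic_curve E"
    and P: "on_curve E P" "P \<noteq> Infinity" "point_neg E P = P"
    and Q: "on_curve E Q" "Q \<noteq> Infinity" "point_neg E Q = Q"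
    and "P \<noteq> Q"
  shows "point_add E P Q \<notin> {Infinity, P, Q}"
proof -
  obtain a1 a2 a3 a4 a6 where E: "E = Weierstrass a1 a2 a3 a4 a6" by (cases E)
  obtain x1 y1 x2 y2 where PQ: "P = Affine x1 y1" "Q = Affine x2 y2"
    using P(2) Q(2) by (cases P; cases Q) auto
  have g: "two_division E x1 = 0" "two_division E x2 = 0"
    using P Q by (auto simp: PQ point_neg_eq_iff)
  have 1: "2 * y1 = - a1 * x1 - a3" using P(3) unfolding PQ E by simp
  have 2: "2 * y2 = - a1 * x2 - a3" using Q(3) unfolding PQ E by simp
  have x12: "x1 \<noteq> x2"
  proof
    assume "x1 = x2"
    then have "2 * y1 = 2 * y2" using 1 2 by simp
    then show False using two \<open>x1 = x2\<close> \<open>P \<noteq> Q\<close> unfolding PQ by simp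
  qed
  let ?l = "(y2 - y1) / (x2 - x1)"
  have "2 * (y2 - y1) = - a1 * (x2 - x1)" using 1 2 by Groebner_Basis.algebra
  then have l: "2 * ?l = - a1" using x12 by (simp add: field_simps)
  let ?x = "?l^2 + a1 * ?l - a2 - x1 - x2"
  have "4 * ?x = - (a1^2) - 4 * a2 - 4 * x1 - 4 * x2" using l by Groebner_Basis.algebra
  then have sum: "4 * ?x + 4 * x1 + 4 * x2 + a1^2 + 4 * a2 = 0" by Groebner_Basis.algebra
  \<comment> \<open>Subtracting the two root conditions gives \<open>x1 - x2\<close> times the
    divided difference of the two-division polynomial; \<open>sum\<close> is the Vieta relation for
    its three roots.\<close>
  have "(x1 - x2) * (4 * (x1^2 + x1 * x2 + x2^2) + (a1^2 + 4 * a2) * (x1 + x2) + 2 * (2 * a4 + a1 * a3)) = 0"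
    using g unfolding E by simp Groebner_Basis.algebra
  then have s2: "4 * (x1^2 + x1 * x2 + x2^2) + (a1^2 + 4 * a2) * (x1 + x2) + 2 * (2 * a4 + a1 * a3) = 0"
    using x12 by simp
  have "?x \<noteq> x1"
  proof
    assume "?x = x1"
    then have "2 * two_division_d1 E x1 = 0" using sum s2 unfolding E by simp Groebner_Basis.algebra
    then show False using double_root_imp_singular[OF two g(1)] two ell by (simp add: elliptic_curve_def)
  qed
  moreover have "?x \<noteq> x2"
  proof
    assume "?x = x2"
    then have "2 * two_division_d1 E x2 = 0" using sum s2 unfolding E by simp Groebner_Basis.algebra
    then show False using double_root_imp_singular[OF two g(2)] two ell by (simp add: elliptic_curve_def)
  qed
  moreover have "point_add E P Q = Affine ?x (- (?l + a1) * ?x - (y1 - ?l * x1) - a3)"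
    using x12 unfolding E PQ by (simp add: Let_def)
  ultimately show ?thesis unfolding PQ by auto
qed

lemma subgroup_fiber:
  fixes E :: "'k::field weierstrass"
  assumes two: "(2::'k) \<noteq> 0" and ell: "elliptic_curve E"
    and psi: "three_division E x = 0" and on: "on_curve E (Affine x y)"
  shows "subgroup (fiber E x) (point_group E)" and "card (fiber E x) = 3"
proof -
  let ?P = "Affine x y"
  note g = two_division_nonzero[OF two ell psi]
  have neq: "point_neg E ?P \<noteq> ?P" using point_neg_eq_iff[OF on] g by simp
  have fin: "point_neg E ?P \<noteq> Infinity" by (cases E) auto
  show "card (fiber E x) = 3" using neq fin by (auto simp: fiber_eq[OF on])
  obtain y' where y': "point_neg E ?P = Affine x y'" by (cases E) auto
  have on': "on_curve E (Affine x y')" using on_curve_point_neg[OF on] y' by simp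
  have y'': "point_neg E (Affine x y') = ?P" using y' point_neg_point_neg by metis
  have PP: "point_add E ?P ?P = Affine x y'" "point_add E (Affine x y') (Affine x y') = ?P"
    using point_add_self(2)[OF two on g psi] point_add_self(2)[OF two on' g psi] y' y'' by auto
  have PQ: "point_add E ?P (Affine x y') = Infinity" "point_add E (Affine x y') ?P = Infinity"
    using y' y'' by (simp_all add: point_add_eq_Infinity_iff)
  have F: "fiber E x = {Infinity, ?P, Affine x y'}" using fiber_eq[OF on] y' by simp
  show "subgroup (fiber E x) (point_group E)"
  proof
    show "fiber E x \<subseteq> carrier (point_group E)" by (auto simp: fiber_def point_group_def)
    show "P \<otimes>\<^bsub>point_group E\<^esub> Q \<in> fiber E x" if "P \<in> fiber E x" "Q \<in> fiber E x" for P Q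
      using that PP PQ unfolding F point_group_def by auto
    show "\<one>\<^bsub>point_group E\<^esub> \<in> fiber E x" by (simp add: F point_group_def)
    show "inv\<^bsub>point_group E\<^esub> P \<in> fiber E x" if "P \<in> fiber E x" for P
    proof -
      have "on_curve E P" using that by (simp add: fiber_def)
      then show ?thesis using that y' y'' unfolding F by (auto simp: inv_point_group)
    qed
  qed
qed

text \<open>Negation permutes the two affine points of \<open>H\<close>. If it fixed one it would
  fix both, and their sum would leave \<open>H\<close>; so it swaps them.\<close>

lemma subgroup_card_3_imp_fiber:
  fixes E :: "'k::field weierstrass"
  assumes two: "(2::'k) \<noteq> 0" and ell: "elliptic_curve E"
    and H: "subgroup H (point_group E)" "card H = 3"
  obtains x y where "three_division E x = 0" "on_curve E (Affine x y)" "H = fiber E x"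
proof -
  have O: "Infinity \<in> H" using subgroup.one_closed[OF H(1)] by (simp add: point_group_def)
  have on: "on_curve E P" if "P \<in> H" for P
    using subgroup.subset[OF H(1)] that by (auto simp: point_group_def)
  have neg: "point_neg E P \<in> H" if "P \<in> H" for P
    using subgroup.m_inv_closed[OF H(1) that] on[OF that] by (simp add: inv_point_group)
  have add: "point_add E P Q \<in> H" if "P \<in> H" "Q \<in> H" for P Q
    using subgroup.m_closed[OF H(1) that] by (simp add: point_group_def)
  have "card (H - {Infinity}) = 2" using O H(2) by (simp add: card_Diff_singleton_if)
  then obtain P Q where PQ: "H - {Infinity} = {P, Q}" "P \<noteq> Q" by (auto simp: card_2_iff)
  then have HPQ: "H = {Infinity, P, Q}" "P \<noteq> Infinity" "Q \<noteq> Infinity" using O by auto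
  have negfin: "point_neg E R \<noteq> Infinity" if "R \<noteq> Infinity" for R
    using that by (cases E; cases R) auto
  have "point_neg E P \<noteq> P"
  proof
    assume P: "point_neg E P = P"
    have "point_neg E Q \<in> {P, Q}" using neg[of Q] HPQ negfin by auto
    then have "point_neg E Q = Q" using P PQ(2) point_neg_point_neg by (metis insertE singletonD)
    then have "point_add E P Q \<notin> {Infinity, P, Q}"
      using point_add_two_torsion[OF two ell] P HPQ PQ(2) on by auto
    then show False using add[of P Q] HPQ by auto
  qed
  then have Q: "Q = point_neg E P" using neg[of P] HPQ negfin by auto
  obtain x y where P: "P = Affine x y" using HPQ by (cases P) auto
  have onP: "on_curve E (Affine x y)" using on[of P] HPQ P by auto
  have g: "two_division E x \<noteq> 0" using point_neg_eq_iff[OF onP] \<open>point_neg E P \<noteq> P\<close> P by auto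
  have "point_add E P P \<noteq> Infinity"
    using \<open>point_neg E P \<noteq> P\<close> by (auto simp: point_add_eq_Infinity_iff)
  then have "point_add E P P \<in> {P, point_neg E P}" using add[of P P] HPQ Q by auto
  \<comment> \<open>Both candidates for the double of \<open>P\<close> have abscissa
    \<open>x\<close>, so one argument covers them.\<close>
  then have "\<exists>y'. point_add E P P = Affine x y'" unfolding P by (cases E) auto
  then have "three_division E x = 0" using point_add_self(1)[OF two onP g] P by simp
  moreover have "H = fiber E x" using fiber_eq[OF onP] HPQ Q P by simp
  ultimately show ?thesis using that onP by blast
qed

section \<open>Frobenius and rational subgroups\<close>

lemma finite_field_power_card: "x ^ CARD('a) = (x :: 'a::{field,finite})"
proof (cases "x = 0")
  case True
  then show ?thesis by simp
next
  case False
  let ?U = "UNIV - {0::'a}"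
  let ?Q = "\<Prod>y\<in>?U. y"
  have "bij_betw ((*) x) ?U ?U"
    using False by (intro bij_betw_byWitness[where f' = "\<lambda>y. y / x"]) auto
  then have "?Q = (\<Prod>y\<in>?U. x * y)" using prod.reindex_bij_betw[of "(*) x" ?U ?U "\<lambda>y. y"] by simp
  also have "\<dots> = x ^ card ?U * ?Q" by (simp add: prod.distrib)
  finally have "x ^ card ?U = 1" by simp
  then have "x ^ Suc (card ?U) = x" by (simp only: power_Suc mult_1_right)
  also have "Suc (card ?U) = CARD('a)" by (simp add: card_Diff_singleton_if)
  finally show ?thesis .
qed

text \<open>The polynomial \<open>(X + 1)^q - X^q - 1\<close> has degree below \<open>q\<close>, yet
  vanishes at all \<open>q\<close> elements because the \<open>q\<close>-th power is the identity
  map there. So it is zero, and its coefficients are these binomials.\<close>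

lemma of_nat_card_choose:
  assumes "0 < k" "k < CARD('a)"
  shows "of_nat (CARD('a) choose k) = (0 :: 'a::{field,finite})"
proof -
  let ?q = "CARD('a)"
  define p :: "'a poly" where "p = (\<Sum>k\<in>{0<..<?q}. Polynomial.monom (of_nat (?q choose k)) k)"
  have "poly p x = 0" for x
  proof -
    have "{..?q} = insert 0 (insert ?q {0<..<?q})" by auto
    then have "(x + 1) ^ ?q = 1 + x ^ ?q + poly p x"
      unfolding binomial_ring by (simp add: p_def poly_sum poly_monom)
    then show ?thesis by (simp add: finite_field_power_card)
  qed
  then have "card {x. poly p x = 0} = ?q" by simp
  moreover have "Polynomial.degree p \<le> ?q - 1"
    unfolding p_def by (rule degree_sum_le) (auto intro: order_trans[OF degree_monom_le])
  ultimately have "p = 0" using card_poly_roots_bound[of p] assms by fastforce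
  moreover have "Polynomial.coeff p k = of_nat (?q choose k)"
    using assms by (simp add: p_def coeff_sum)
  ultimately show ?thesis by simp
qed

lemma frobenius_add: "(x + y :: 'a::{field,finite} alg_closure) ^ CARD('a) = x ^ CARD('a) + y ^ CARD('a)"
proof -
  let ?q = "CARD('a)"
  have "of_nat (?q choose k) = (0 :: 'a alg_closure)" if "k \<in> {0<..<?q}" for k
    using of_nat_card_choose[of k, where 'a = 'a] that to_ac_of_nat[of "?q choose k", where 'a = 'a] by simp
  then have "(\<Sum>k\<in>{0<..<?q}. of_nat (?q choose k) * x ^ k * y ^ (?q - k)) = 0" by simp
  moreover have "{..?q} = insert 0 (insert ?q {0<..<?q})" by auto
  ultimately show ?thesis unfolding binomial_ring by simp
qed

lemma frobenius_to_ac [simp]: "(to_ac (x :: 'a::{field,finite})) ^ CARD('a) = to_ac x"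
  by (simp add: finite_field_power_card flip: to_ac_power)

text \<open>\<open>X^q - X\<close> has at most \<open>q\<close> roots in the closure, and the
  embedded base field already supplies \<open>q\<close> of them.\<close>

lemma frobenius_fixed_iff: "x ^ CARD('a) = x \<longleftrightarrow> x \<in> range (to_ac :: 'a::{field,finite} \<Rightarrow> _)"
proof -
  let ?q = "CARD('a)"
  let ?p = "Polynomial.monom 1 ?q - Polynomial.monom (1 :: 'a alg_closure) 1"
  have q: "1 < ?q" using card_mono[of UNIV "{0, 1 :: 'a}"] by simp
  have "Polynomial.coeff ?p ?q \<noteq> 0" using q by simp
  then have "?p \<noteq> 0" by (metis coeff_0)
  moreover have "Polynomial.degree ?p \<le> ?q"
    using q by (intro degree_diff_le order_trans[OF degree_monom_le]) auto
  moreover have "{x. poly ?p x = 0} = {x. x ^ ?q = x}" by (simp add: poly_monom)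
  ultimately have "card {x :: 'a alg_closure. x ^ ?q = x} \<le> ?q"
    and "finite {x :: 'a alg_closure. x ^ ?q = x}"
    using card_poly_roots_bound[of ?p] poly_roots_finite[of ?p] by auto
  moreover have "card (range (to_ac :: 'a \<Rightarrow> _)) = ?q" by (simp add: card_image inj_to_ac)
  moreover have "range (to_ac :: 'a \<Rightarrow> _) \<subseteq> {x. x ^ ?q = x}" by auto
  ultimately have "range (to_ac :: 'a \<Rightarrow> _) = {x. x ^ ?q = x}" by (intro card_seteq) auto
  then show ?thesis by blast
qed

lemma inj_frobenius: "inj (\<lambda>x :: 'a::{field,finite} alg_closure. x ^ CARD('a))"
proof (rule injI)
  fix x y :: "'a alg_closure"
  assume "x ^ CARD('a) = y ^ CARD('a)"
  moreover have "x ^ CARD('a) = (x - y) ^ CARD('a) + y ^ CARD('a)"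
    using frobenius_add[of "x - y" y] by simp
  ultimately show "x = y" by simp
qed

abbreviation geometric_curve :: "'a::field weierstrass \<Rightarrow> 'a alg_closure weierstrass" where
  "geometric_curve \<equiv> map_weierstrass to_ac"

lemma three_division_to_ac: "three_division (geometric_curve E) (to_ac x) = to_ac (three_division E x)"
  by (cases E) simp

lemma discriminant_to_ac: "discriminant (geometric_curve E) = to_ac (discriminant E)"
  by (cases E) (simp add: Let_def)

lemma elliptic_to_ac: "elliptic_curve (geometric_curve E) \<longleftrightarrow> elliptic_curve E"
  by (simp add: elliptic_curve_def discriminant_to_ac)

lemma exists_affine_point:
  fixes E :: "'k::alg_closed_field weierstrass"
  obtains y where "on_curve E (Affine x y)"
proof -
  obtain a1 a2 a3 a4 a6 where E: "E = Weierstrass a1 a2 a3 a4 a6" by (cases E)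
  let ?p = "[:- (x^3 + a2 * x^2 + a4 * x + a6), a1 * x + a3, 1:]"
  have "Polynomial.degree ?p > 0" by simp
  then obtain y where "poly ?p y = 0" using alg_closed_imp_poly_has_root by blast
  then have "on_curve E (Affine x y)" by (simp add: E algebra_simps power2_eq_square)
  then show ?thesis by (rule that)
qed

lemma frobenius_simps [simp]:
  "frobenius Infinity = (Infinity :: 'a::{field,finite} alg_closure point)"
  "frobenius (Affine x y) = Affine (x ^ CARD('a)) (y ^ CARD('a) :: 'a::{field,finite} alg_closure)"
  by (simp_all add: frobenius_def)

lemma on_curve_frobenius:
  fixes E :: "'a::{field,finite} weierstrass"
  assumes "on_curve (geometric_curve E) P"
  shows "on_curve (geometric_curve E) (frobenius P)"
proof (cases P)
  case (Affine x y)
  obtain a1 a2 a3 a4 a6 where E: "E = Weierstrass a1 a2 a3 a4 a6" by (cases E)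
  let ?q = "CARD('a)"
  have comm: "(z ^ n) ^ ?q = (z ^ ?q) ^ n" for z :: "'a alg_closure" and n
    by (simp add: mult.commute flip: power_mult)
  have "(y^2 + to_ac a1 * x * y + to_ac a3 * y) ^ ?q =
      (x^3 + to_ac a2 * x^2 + to_ac a4 * x + to_ac a6) ^ ?q"
    using assms by (simp add: Affine E)
  then show ?thesis
    by (simp only: frobenius_add power_mult_distrib frobenius_to_ac comm)
      (simp add: Affine E)
qed simp

text \<open>Some point lies over \<open>x\<close>, and Frobenius sends it to a point over
  \<open>x^q\<close>; stability forces \<open>x^q = x\<close>. Conversely, an injective map of the
  finite fiber into itself is onto.\<close>

lemma frobenius_fiber:
  fixes E :: "'a::{field,finite} weierstrass"
  shows "frobenius ` fiber (geometric_curve E) x = fiber (geometric_curve E) x \<longleftrightarrow> x \<in> range to_ac"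
proof -
  let ?F = "fiber (geometric_curve E) x"
  obtain y where on: "on_curve (geometric_curve E) (Affine x y)" by (rule exists_affine_point)
  have "x ^ CARD('a) = x" if "frobenius ` ?F = ?F"
  proof -
    have "Affine x y \<in> ?F" using on by (simp add: fiber_def)
    then have "frobenius (Affine x y) \<in> ?F" using that by blast
    then show ?thesis by (simp add: fiber_def)
  qed
  moreover have "frobenius ` ?F = ?F" if x: "x ^ CARD('a) = x"
  proof (rule endo_inj_surj)
    show "finite ?F" by (simp add: fiber_eq[OF on])
    show "frobenius ` ?F \<subseteq> ?F" using on_curve_frobenius x by (fastforce simp: fiber_def)
    have "inj (frobenius :: 'a alg_closure point \<Rightarrow> _)"
      unfolding frobenius_def by (rule point.inj_map[OF inj_frobenius])
    then show "inj_on frobenius ?F" using inj_on_subset by blast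
  qed
  ultimately show ?thesis unfolding frobenius_fixed_iff[symmetric] by blast
qed

text \<open>With the abscissa fixed, Frobenius sends the point to itself or to its negative. The
  negative has coefficients in the base field, so a second application restores
  \<open>y\<close>.\<close>

lemma affine_point_over_quadratic_extension:
  fixes E :: "'a::{field,finite} weierstrass"
  assumes on: "on_curve (geometric_curve E) (Affine (to_ac x) y)"
  shows "y \<in> quadratic_extension"
proof -
  let ?q = "CARD('a)"
  have "Affine (to_ac x) (y ^ ?q) \<in> fiber (geometric_curve E) (to_ac x)"
    using on_curve_frobenius[OF on] by (simp add: fiber_def)
  then have "Affine (to_ac x) (y ^ ?q) = Affine (to_ac x) y \<or>
      Affine (to_ac x) (y ^ ?q) = point_neg (geometric_curve E) (Affine (to_ac x) y)"
    by (simp add: fiber_eq[OF on])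
  then have "(y ^ ?q) ^ ?q = y"
  proof
    assume "Affine (to_ac x) (y ^ ?q) = Affine (to_ac x) y"
    then show ?thesis by simp
  next
    assume neg: "Affine (to_ac x) (y ^ ?q) = point_neg (geometric_curve E) (Affine (to_ac x) y)"
    obtain a1 a2 a3 a4 a6 where E: "E = Weierstrass a1 a2 a3 a4 a6" by (cases E)
    let ?c = "to_ac (a1 * x + a3)"
    have sum: "y ^ ?q + (y + ?c) = 0" using neg by (simp add: E)
    then have "(y ^ ?q) ^ ?q + (y ^ ?q + ?c) = 0"
      using frobenius_add[of "y ^ ?q" "y + ?c"] frobenius_add[of y ?c]
      by (simp add: power_0_left del: to_ac_add to_ac_mult)
    also have "\<dots> = y + (y ^ ?q + ?c)" using sum by (simp only: add.left_commute)
    finally show ?thesis by (simp only: add_right_cancel)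
  qed
  then show ?thesis
    by (simp add: quadratic_extension_def power2_eq_square power_mult)
qed

text \<open>This is the quadratic formula for \<open>y\<close>, with the two-division value as
  discriminant.\<close>

lemma affine_point_over_base_field_iff:
  fixes E :: "'a::{field,finite} weierstrass"
  assumes two: "(2::'a) \<noteq> 0"
  shows "(\<exists>y\<in>base_field. on_curve (geometric_curve E) (Affine (to_ac x) y)) \<longleftrightarrow>
    (\<exists>s. s^2 = two_division E x)"
proof -
  obtain a1 a2 a3 a4 a6 where E: "E = Weierstrass a1 a2 a3 a4 a6" by (cases E)
  have on: "on_curve (geometric_curve E) (Affine (to_ac x) (to_ac y)) \<longleftrightarrow> on_curve E (Affine x y)" for y
    by (simp add: E flip: to_ac_mult to_ac_power to_ac_add)
  have four: "(4::'a) \<noteq> 0" by (rule four_nonzero[OF two])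
  have "on_curve E (Affine x y)" if "s^2 = two_division E x" and y: "y = (s - a1 * x - a3) / 2" for s y
  proof -
    have "2 * y = s - a1 * x - a3" using two by (simp add: y)
    then have s: "s = 2 * y + a1 * x + a3" by simp
    have "4 * (y^2 + a1 * x * y + a3 * y) = 4 * (x^3 + a2 * x^2 + a4 * x + a6)"
      using that(1) unfolding s E by (simp add: algebra_simps power2_eq_square)
    then show ?thesis using four by (simp only: mult_cancel_left) (simp add: E)
  qed
  moreover have "two_division E x = (2 * y + a1 * x + a3)^2" if "on_curve E (Affine x y)" for y
    using two_division_on_curve that unfolding E by blast
  ultimately have "(\<exists>y. on_curve E (Affine x y)) \<longleftrightarrow> (\<exists>s. s^2 = two_division E x)" by metis
  then show ?thesis by (auto simp: base_field_def on)
qed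

lemma inj_image_eq_singleton_iff:
  assumes "inj f"
  shows "f ` A = {y} \<longleftrightarrow> (\<exists>x. y = f x \<and> A = {x})"
proof
  assume eq: "f ` A = {y}"
  then obtain x where x: "y = f x" by blast
  then have "f ` A = f ` {x}" using eq by simp
  then have "A = {x}" by (simp only: inj_image_eq_iff[OF assms])
  then show "\<exists>x. y = f x \<and> A = {x}" using x by blast
qed auto

theorem only_one_rational_3_subgroup_quadratic_iff:
  fixes E :: "'a::{field,finite} weierstrass"
  assumes two: "(2::'a) \<noteq> 0" and ell: "elliptic_curve E"
  shows "only_one_rational_3_subgroup_quadratic E \<longleftrightarrow>
    (\<exists>x. {x. three_division E x = 0} = {x} \<and> (\<nexists>s. s^2 = two_division E x))"
proof -
  let ?E = "geometric_curve E"
  let ?S = "{H. rational_subgroup E H \<and> card H = 3}"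
  let ?R = "{x. three_division E x = 0}"
  let ?f = "\<lambda>x. fiber ?E (to_ac x)"
  have two': "(2 :: 'a alg_closure) \<noteq> 0" using two to_ac_numeral[where 'a = 'a] to_ac_eq_0_iff by metis
  have ell': "elliptic_curve ?E" using ell by (simp add: elliptic_to_ac)
  have "?S = ?f ` ?R"
  proof (intro equalityI subsetI)
    fix H assume "H \<in> ?S"
    then have H: "subgroup H (point_group ?E)" "card H = 3" "frobenius ` H = H"
      by (auto simp: rational_subgroup_def)
    obtain x where x: "three_division ?E x = 0" "H = fiber ?E x"
      by (rule subgroup_card_3_imp_fiber[OF two' ell' H(1,2)])
    have "x \<in> range to_ac" using H(3) unfolding x(2) by (rule frobenius_fiber[THEN iffD1])
    then obtain z where z: "x = to_ac z" by (rule rangeE)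
    then show "H \<in> ?f ` ?R" using x by (auto simp: three_division_to_ac)
  next
    fix H assume "H \<in> ?f ` ?R"
    then obtain x where x: "three_division E x = 0" "H = ?f x" by auto
    obtain y where on: "on_curve ?E (Affine (to_ac x) y)" by (rule exists_affine_point)
    have "three_division ?E (to_ac x) = 0" using x by (simp add: three_division_to_ac)
    note subgroup_fiber[OF two' ell' this on]
    moreover have "frobenius ` H = H" unfolding x frobenius_fiber by simp
    ultimately show "H \<in> ?S" by (simp add: x rational_subgroup_def)
  qed
  moreover have "inj ?f"
  proof (rule injI)
    fix x x' assume eq: "?f x = ?f x'"
    obtain y where "on_curve ?E (Affine (to_ac x) y)" by (rule exists_affine_point)
    then have "Affine (to_ac x) y \<in> ?f x'" unfolding eq[symmetric] by (simp add: fiber_def)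
    then show "x = x'" by (simp add: fiber_def)
  qed
  ultimately have S: "?S = {H} \<longleftrightarrow> (\<exists>x. H = ?f x \<and> ?R = {x})" for H
    by (simp only: inj_image_eq_singleton_iff)
  have P: "(\<forall>P\<in>?f x. P \<noteq> Infinity \<longrightarrow>
         defined_over quadratic_extension P \<and> \<not> defined_over base_field P) \<longleftrightarrow>
      (\<nexists>s. s^2 = two_division E x)" (is "?L \<longleftrightarrow> _") for x
  proof -
    have "to_ac x \<in> quadratic_extension"
      by (simp add: quadratic_extension_def power2_eq_square power_mult)
    moreover have "to_ac x \<in> base_field" by (simp add: base_field_def)
    \<comment> \<open>The abscissa lies in both fields, so only the ordinate decides the field of
      definition.\<close>
    ultimately have "?L \<longleftrightarrow> \<not> (\<exists>y\<in>base_field. on_curve ?E (Affine (to_ac x) y))"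
      by (auto simp: fiber_def defined_over_def intro: affine_point_over_quadratic_extension)
    then show ?thesis unfolding affine_point_over_base_field_iff[OF two] .
  qed
  show ?thesis unfolding only_one_rational_3_subgroup_quadratic_def S using P by blast
qed

section \<open>Changes of variables\<close>

lemma change_of_variablesD:
  assumes "change_of_variables u r s w (Weierstrass a1 a2 a3 a4 a6) (Weierstrass c1 c2 c3 c4 c6)"
  shows "u * c1 = a1 + 2 * s"
    and "u^2 * c2 = a2 - s * a1 + 3 * r - s^2"
    and "u^3 * c3 = a3 + r * a1 + 2 * w"
    and "u^4 * c4 = a4 - s * a3 + 2 * r * a2 - (w + r * s) * a1 + 3 * r^2 - 2 * s * w"
    and "u^6 * c6 = a6 + r * a4 + r^2 * a2 + r^3 - w * a3 - w^2 - r * w * a1"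
  using assms unfolding change_of_variables.simps by blast+

text \<open>The change of \<open>y\<close> only alters how the square is completed, so the
  two-division polynomial transforms by \<open>x = u^2 x' + r\<close> with weight 6. Differentiating
  once and twice lowers the weight to 4 and 2.\<close>

lemma change_of_variables_transform:
  assumes "change_of_variables u r s w E E'"
  shows "u^2 * two_division_d2 E' x = two_division_d2 E (u^2 * x + r)" (is ?d2)
    and "u^4 * two_division_d1 E' x = two_division_d1 E (u^2 * x + r)" (is ?d1)
    and "u^6 * two_division E' x = two_division E (u^2 * x + r)" (is ?two)
proof -
  obtain a1 a2 a3 a4 a6 where E: "E = Weierstrass a1 a2 a3 a4 a6" by (cases E)
  obtain c1 c2 c3 c4 c6 where E': "E' = Weierstrass c1 c2 c3 c4 c6" by (cases E')
  let ?x = "u^2 * x"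
  note eqs = change_of_variablesD[OF assms[unfolded E E']]
  \<comment> \<open>The hypotheses determine only products such as \<open>u * c1\<close> and
    \<open>u^2 * c2\<close>, so each expression is regrouped into these before rewriting.\<close>
  have "u^2 * two_division_d2 E' x = 12 * ?x + (u * c1)^2 + 4 * (u^2 * c2)"
    unfolding E' by simp Groebner_Basis.algebra
  also have "\<dots> = two_division_d2 E (?x + r)"
    unfolding E two_division_d2.simps eqs by Groebner_Basis.algebra
  finally show ?d2 .
  have "u^4 * two_division_d1 E' x =
      6 * ?x^2 + ((u * c1)^2 + 4 * (u^2 * c2)) * ?x + (2 * (u^4 * c4) + (u * c1) * (u^3 * c3))"
    unfolding E' by simp Groebner_Basis.algebra
  also have "\<dots> = two_division_d1 E (?x + r)"
    unfolding E two_division_d1.simps eqs by Groebner_Basis.algebra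
  finally show ?d1 .
  have "u^6 * two_division E' x = ((u * c1) * ?x + u^3 * c3)^2 +
      4 * (?x^3 + (u^2 * c2) * ?x^2 + (u^4 * c4) * ?x + u^6 * c6)"
    unfolding E' by simp Groebner_Basis.algebra
  also have "\<dots> = two_division E (?x + r)"
    unfolding E two_division.simps eqs by Groebner_Basis.algebra
  finally show ?two .
qed

lemma change_of_variables_three_division:
  fixes E E' :: "'k::field weierstrass"
  assumes "(2::'k) \<noteq> 0" and cov: "change_of_variables u r s w E E'"
  shows "u^8 * three_division E' x = three_division E (u^2 * x + r)"
proof -
  have "4 * (u^8 * three_division E' x) = u^8 * (4 * three_division E' x)" by simp
  also have "\<dots> = (u^2 * two_division_d2 E' x) * (u^6 * two_division E' x)
      - (u^4 * two_division_d1 E' x)^2"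
    unfolding four_three_division by Groebner_Basis.algebra
  also have "\<dots> = 4 * three_division E (u^2 * x + r)"
    unfolding change_of_variables_transform[OF cov] four_three_division ..
  finally show ?thesis using four_nonzero[OF assms(1)] by (simp only: mult_cancel_left) simp
qed

text \<open>\<open>E'\<close> is expanded at \<open>0\<close> and \<open>E\<close> at the
  corresponding abscissa \<open>r\<close>; each term of the expansion has total weight 12.\<close>

lemma change_of_variables_discriminant:
  fixes E E' :: "'k::field weierstrass"
  assumes "(2::'k) \<noteq> 0" and cov: "change_of_variables u r s w E E'"
  shows "u^12 * discriminant E' = discriminant E"
proof -
  have "u^12 * discriminant E' =
      - ((u^2 * two_division_d2 E' 0)^2 * (u^8 * three_division E' 0))
      - 8 * (u^4 * two_division_d1 E' 0)^3 - 27 * (u^6 * two_division E' 0)^2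
      + 9 * (u^2 * two_division_d2 E' 0) * (u^4 * two_division_d1 E' 0) * (u^6 * two_division E' 0)"
    unfolding discriminant_shift[of E' 0] by Groebner_Basis.algebra
  also have "\<dots> = discriminant E"
    unfolding change_of_variables_transform[OF cov] change_of_variables_three_division[OF assms]
      discriminant_shift[of E "u^2 * 0 + r"] ..
  finally show ?thesis .
qed

text \<open>The parameters come from solving \<open>x = u^2 x' + r\<close> and
  \<open>y = u^3 y' + u^2 s x' + w\<close> for \<open>x'\<close> and \<open>y'\<close>.\<close>

lemma change_of_variables_inverse:
  assumes "u \<noteq> 0" and "change_of_variables u r s w E E'"
  shows "change_of_variables (1 / u) (- (r / u^2)) (- (s / u)) ((r * s - w) / u^3) E' E"
proof -
  obtain a1 a2 a3 a4 a6 where E: "E = Weierstrass a1 a2 a3 a4 a6" by (cases E)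
  obtain c1 c2 c3 c4 c6 where E': "E' = Weierstrass c1 c2 c3 c4 c6" by (cases E')
  note eqs = change_of_variablesD[OF assms(2)[unfolded E E']]
  have c: "c1 = (a1 + 2 * s) / u" "c2 = (a2 - s * a1 + 3 * r - s^2) / u^2"
    "c3 = (a3 + r * a1 + 2 * w) / u^3"
    "c4 = (a4 - s * a3 + 2 * r * a2 - (w + r * s) * a1 + 3 * r^2 - 2 * s * w) / u^4"
    "c6 = (a6 + r * a4 + r^2 * a2 + r^3 - w * a3 - w^2 - r * w * a1) / u^6"
    using eqs assms(1) by (simp_all add: eq_divide_eq mult.commute)
  show ?thesis unfolding E E' change_of_variables.simps c
    using assms(1) by (simp add: divide_simps) Groebner_Basis.algebra
qed

text \<open>The parameters are found by inserting the second substitution into the first and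
  collecting the coefficients of \<open>x''\<close> and 1.\<close>

lemma change_of_variables_compose:
  assumes "change_of_variables u r s w E E'" and "change_of_variables u' r' s' w' E' E''"
  shows "change_of_variables (u * u') (u^2 * r' + r) (u * s' + s) (u^3 * w' + u^2 * s * r' + w) E E''"
proof -
  obtain a1 a2 a3 a4 a6 where E: "E = Weierstrass a1 a2 a3 a4 a6" by (cases E)
  obtain c1 c2 c3 c4 c6 where E': "E' = Weierstrass c1 c2 c3 c4 c6" by (cases E')
  obtain d1 d2 d3 d4 d6 where E'': "E'' = Weierstrass d1 d2 d3 d4 d6" by (cases E'')
  note eqs = change_of_variablesD[OF assms(1)[unfolded E E']]
  note eqs' = change_of_variablesD[OF assms(2)[unfolded E' E'']]
  have "(u * u') * d1 = u * (u' * d1)" by simp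
  also have "\<dots> = u * c1 + 2 * (u * s')" unfolding eqs' by Groebner_Basis.algebra
  also have "\<dots> = a1 + 2 * (u * s' + s)" unfolding eqs by Groebner_Basis.algebra
  finally have 1: "(u * u') * d1 = \<dots>" .
  have "(u * u')^2 * d2 = u^2 * (u'^2 * d2)" by (simp add: power_mult_distrib)
  also have "\<dots> = u^2 * c2 - (u * s') * (u * c1) + 3 * (u^2 * r') - (u * s')^2"
    unfolding eqs' by Groebner_Basis.algebra
  also have "\<dots> = a2 - (u * s' + s) * a1 + 3 * (u^2 * r' + r) - (u * s' + s)^2"
    unfolding eqs by Groebner_Basis.algebra
  finally have 2: "(u * u')^2 * d2 = \<dots>" .
  have "(u * u')^3 * d3 = u^3 * (u'^3 * d3)" by (simp add: power_mult_distrib)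
  also have "\<dots> = u^3 * c3 + (u^2 * r') * (u * c1) + 2 * (u^3 * w')"
    unfolding eqs' by Groebner_Basis.algebra
  also have "\<dots> = a3 + (u^2 * r' + r) * a1 + 2 * (u^3 * w' + u^2 * s * r' + w)"
    unfolding eqs by Groebner_Basis.algebra
  finally have 3: "(u * u')^3 * d3 = \<dots>" .
  have "(u * u')^4 * d4 = u^4 * (u'^4 * d4)" by (simp add: power_mult_distrib)
  also have "\<dots> = u^4 * c4 - (u * s') * (u^3 * c3) + 2 * (u^2 * r') * (u^2 * c2)
      - (u^3 * w' + (u^2 * r') * (u * s')) * (u * c1) + 3 * (u^2 * r')^2 - 2 * (u * s') * (u^3 * w')"
    unfolding eqs' by Groebner_Basis.algebra
  also have "\<dots> = a4 - (u * s' + s) * a3 + 2 * (u^2 * r' + r) * a2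
      - (u^3 * w' + u^2 * s * r' + w + (u^2 * r' + r) * (u * s' + s)) * a1
      + 3 * (u^2 * r' + r)^2 - 2 * (u * s' + s) * (u^3 * w' + u^2 * s * r' + w)"
    unfolding eqs by Groebner_Basis.algebra
  finally have 4: "(u * u')^4 * d4 = \<dots>" .
  have "(u * u')^6 * d6 = u^6 * (u'^6 * d6)" by (simp add: power_mult_distrib)
  also have "\<dots> = u^6 * c6 + (u^2 * r') * (u^4 * c4) + (u^2 * r')^2 * (u^2 * c2)
      + (u^2 * r')^3 - (u^3 * w') * (u^3 * c3) - (u^3 * w')^2 - (u^2 * r') * (u^3 * w') * (u * c1)"
    unfolding eqs' by Groebner_Basis.algebra
  also have "\<dots> = a6 + (u^2 * r' + r) * a4 + (u^2 * r' + r)^2 * a2 + (u^2 * r' + r)^3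
      - (u^3 * w' + u^2 * s * r' + w) * a3 - (u^3 * w' + u^2 * s * r' + w)^2
      - (u^2 * r' + r) * (u^3 * w' + u^2 * s * r' + w) * a1"
    unfolding eqs by Groebner_Basis.algebra
  finally have 6: "(u * u')^6 * d6 = \<dots>" .
  show ?thesis unfolding E E'' change_of_variables.simps using 1 2 3 4 6 by blast
qed

lemma change_of_variables_refl: "change_of_variables 1 0 0 0 E E"
  by (cases E) simp

lemma change_of_variables_elliptic:
  fixes E E' :: "'k::field weierstrass"
  assumes "(2::'k) \<noteq> 0" "u \<noteq> 0" "change_of_variables u r s w E E'"
  shows "elliptic_curve E' \<longleftrightarrow> elliptic_curve E"
  using change_of_variables_discriminant[OF assms(1,3)] assms(2)
  by (auto simp: elliptic_curve_def)

lemma equiv_curve_isomorphism: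
  "equiv {E :: 'a::field weierstrass. elliptic_curve E} curve_isomorphism"
proof (rule equivI)
  let ?iso = "curve_isomorphism :: ('a weierstrass \<times> _) set"
  show "?iso \<subseteq> {E. elliptic_curve E} \<times> {E. elliptic_curve E}"
    by (auto simp: curve_isomorphism_def)
  show "refl_on {E. elliptic_curve E} ?iso"
    unfolding refl_on_def curve_isomorphism_def using change_of_variables_refl one_neq_zero by blast
  show "sym ?iso"
  proof (rule symI)
    fix E E' :: "'a weierstrass"
    assume "(E, E') \<in> curve_isomorphism"
    then obtain u r s w where ell: "elliptic_curve E" "elliptic_curve E'"
      and u: "u \<noteq> 0" and cov: "change_of_variables u r s w E E'"
      by (auto simp: curve_isomorphism_def)
    have "1 / u \<noteq> 0" using u by simp
    then show "(E', E) \<in> curve_isomorphism"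
      using change_of_variables_inverse[OF u cov] ell unfolding curve_isomorphism_def by blast
  qed
  show "trans ?iso"
  proof (rule transI)
    fix E E' E'' :: "'a weierstrass"
    assume "(E, E') \<in> curve_isomorphism" "(E', E'') \<in> curve_isomorphism"
    then obtain u r s w u' r' s' w' where ell: "elliptic_curve E" "elliptic_curve E''"
      and u: "u \<noteq> 0" "u' \<noteq> 0" and cov: "change_of_variables u r s w E E'"
        "change_of_variables u' r' s' w' E' E''"
      by (auto simp: curve_isomorphism_def)
    have "u * u' \<noteq> 0" using u by simp
    then show "(E, E'') \<in> curve_isomorphism"
      using change_of_variables_compose[OF cov] ell unfolding curve_isomorphism_def by blast
  qed
qed

lemma special_curves_iff:
  fixes E :: "'a::{field,finite} weierstrass"
  assumes "(2::'a) \<noteq> 0"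
  shows "E \<in> special_curves \<longleftrightarrow> elliptic_curve E \<and>
    (\<exists>x. {x. three_division E x = 0} = {x} \<and> (\<nexists>s. s^2 = two_division E x))"
  unfolding special_curves_def using only_one_rational_3_subgroup_quadratic_iff[OF assms] by blast

text \<open>The affine map \<open>x' \<mapsto> u^2 x' + r\<close> matches the roots, and the
  two-division values differ by the square \<open>u^6\<close>.\<close>

lemma special_curves_isomorphic:
  fixes E E' :: "'a::{field,finite} weierstrass"
  assumes two: "(2::'a) \<noteq> 0" and E: "E \<in> special_curves" and iso: "(E, E') \<in> curve_isomorphism"
  shows "E' \<in> special_curves"
proof -
  obtain u r s w where ell: "elliptic_curve E'"
      and u: "u \<noteq> 0" and cov: "change_of_variables u r s w E E'"
    using iso by (auto simp: curve_isomorphism_def)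
  obtain x where x: "{x. three_division E x = 0} = {x}" and d: "\<nexists>s. s^2 = two_division E x"
    using E special_curves_iff[OF two] by blast
  define x' where "x' = (x - r) / u^2"
  have x': "u^2 * x' + r = x" using u by (simp add: x'_def)
  have "three_division E' z = 0 \<longleftrightarrow> z = x'" for z
  proof -
    have "three_division E' z = 0 \<longleftrightarrow> three_division E (u^2 * z + r) = 0"
      using change_of_variables_three_division[OF two cov, of z, symmetric] u by simp
    also have "\<dots> \<longleftrightarrow> u^2 * z + r = x" using x by blast
    also have "\<dots> \<longleftrightarrow> z = x'" unfolding x'[symmetric] using u by simp
    finally show ?thesis .
  qed
  then have "{x. three_division E' x = 0} = {x'}" by blast
  moreover have "s^2 \<noteq> two_division E' x'" for s
  proof
    assume "s^2 = two_division E' x'"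
    then have "(u^3 * s)^2 = u^6 * two_division E' x'" by (simp add: power_mult_distrib flip: power_mult)
    then show False using d unfolding change_of_variables_transform(3)[OF cov] x' by blast
  qed
  ultimately show ?thesis using ell special_curves_iff[OF two] by blast
qed

section \<open>The normal form\<close>

text \<open>Completing the square in \<open>y^2 + a x y + b y = x^3\<close> adds
  \<open>(a x + b)^2 / 4\<close> to the right-hand side; twisting by \<open>t\<close> multiplies the
  coefficients by \<open>t\<close>, \<open>t^2\<close>, \<open>t^3\<close>.\<close>

definition twisted_curve :: "'k::field \<Rightarrow> 'k \<Rightarrow> 'k \<Rightarrow> 'k weierstrass" where
  "twisted_curve t a b = Weierstrass 0 (t * a^2 / 4) 0 (t^2 * a * b / 2) (t^3 * b^2 / 4)"

lemma three_division_twisted_curve: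
  fixes t a b :: "'k::field"
  assumes two: "(2::'k) \<noteq> 0"
  shows "three_division (twisted_curve t a b) x =
    x * (3 * x^3 + t * a^2 * x^2 + 3 * t^2 * a * b * x + 3 * t^3 * b^2)"
proof -
  define A B C where "A = t * a^2 / 4" and "B = t^2 * a * b / 2" and "C = t^3 * b^2 / 4"
  have ABC: "4 * A = t * a^2" "2 * B = t^2 * a * b" "4 * C = t^3 * b^2"
    using two four_nonzero[OF two] by (simp_all add: A_def B_def C_def)
  \<comment> \<open>The quadratic with coefficients \<open>A\<close>, \<open>B\<close>,
    \<open>C\<close> is a multiple of a perfect square, so its discriminant, the constant term of
    the three-division polynomial up to sign, vanishes.\<close>
  have "4 * (4 * A * C) = 4 * B^2" using ABC by Groebner_Basis.algebra
  then have "4 * A * C = B^2" using four_nonzero[OF two] by (simp only: mult_cancel_left) simp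
  then have AC: "4 * A * C - B^2 = 0" by simp
  have "three_division (Weierstrass 0 A 0 B C) x =
      3 * x^4 + (4 * A) * x^3 + 3 * (2 * B) * x^2 + 3 * (4 * C) * x + (4 * A * C - B^2)"
    by simp
  also have "\<dots> = x * (3 * x^3 + t * a^2 * x^2 + 3 * t^2 * a * b * x + 3 * t^3 * b^2)"
    unfolding AC unfolding ABC by Groebner_Basis.algebra
  finally show ?thesis unfolding twisted_curve_def A_def B_def C_def .
qed

lemma two_division_twisted_curve:
  fixes t a b :: "'k::field"
  assumes two: "(2::'k) \<noteq> 0"
  shows "two_division (twisted_curve t a b) 0 = t^3 * b^2"
  using four_nonzero[OF two] by (simp add: twisted_curve_def)

lemma discriminant_twisted_curve:
  fixes t a b :: "'k::field"
  assumes two: "(2::'k) \<noteq> 0"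
  shows "discriminant (twisted_curve t a b) = t^6 * b^3 * (a^3 - 27 * b)"
proof -
  have "two_division_d1 (twisted_curve t a b) 0 = t^2 * a * b"
    "two_division_d2 (twisted_curve t a b) 0 = t * a^2"
    using two four_nonzero[OF two] by (simp_all add: twisted_curve_def)
  then have "discriminant (twisted_curve t a b) =
      - 8 * (t^2 * a * b)^3 - 27 * (t^3 * b^2)^2 + 9 * (t * a^2) * (t^2 * a * b) * (t^3 * b^2)"
    unfolding discriminant_shift[of _ 0]
    by (simp add: two_division_twisted_curve[OF two] three_division_twisted_curve[OF two])
  also have "\<dots> = t^6 * b^3 * (a^3 - 27 * b)" by Groebner_Basis.algebra
  finally show ?thesis .
qed

lemma elliptic_twisted_curve:
  fixes t a b :: "'k::field"
  assumes "(2::'k) \<noteq> 0"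
  shows "elliptic_curve (twisted_curve t a b) \<longleftrightarrow> t \<noteq> 0 \<and> b \<noteq> 0 \<and> a^3 \<noteq> 27 * b"
  by (simp add: elliptic_curve_def discriminant_twisted_curve[OF assms])

text \<open>Multiplied by \<open>9 * b\<close>, the cubic factor becomes
  \<open>(3 * b * t + a * x)^3 - (a^3 - 27 * b) * x^3\<close>. Thus nonzero roots and cube roots
  correspond by \<open>c = a + 3 * b * t / x\<close>, solved as
  \<open>x = 3 * b * t / (c - a)\<close>; the value \<open>c = a\<close> is impossible as
  \<open>27 * b \<noteq> 0\<close>.\<close>

lemma three_division_twisted_curve_root_iff:
  fixes t a b :: "'k::field"
  assumes two: "(2::'k) \<noteq> 0" and three: "(3::'k) \<noteq> 0" and "t \<noteq> 0" "b \<noteq> 0"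
  shows "(\<exists>x. x \<noteq> 0 \<and> three_division (twisted_curve t a b) x = 0) \<longleftrightarrow> (\<exists>c. c^3 = a^3 - 27 * b)"
proof -
  have nine: "(9::'k) \<noteq> 0"
  proof -
    have "(9::'k) = 3 * 3" by simp
    then show ?thesis using three by (metis mult_eq_0_iff)
  qed
  have root: "three_division (twisted_curve t a b) x = 0 \<longleftrightarrow>
      (3 * b * t + a * x)^3 = (a^3 - 27 * b) * x^3" if "x \<noteq> 0" for x
  proof -
    have "9 * b * (3 * x^3 + t * a^2 * x^2 + 3 * t^2 * a * b * x + 3 * t^3 * b^2) =
        (3 * b * t + a * x)^3 - (a^3 - 27 * b) * x^3" by Groebner_Basis.algebra
    moreover have "9 * b \<noteq> 0" using nine \<open>b \<noteq> 0\<close> by simp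
    ultimately show ?thesis using \<open>x \<noteq> 0\<close>
      unfolding three_division_twisted_curve[OF two] by (metis eq_iff_diff_eq_0 mult_eq_0_iff)
  qed
  show ?thesis
  proof
    assume "\<exists>x. x \<noteq> 0 \<and> three_division (twisted_curve t a b) x = 0"
    then obtain x where "x \<noteq> 0" and "(3 * b * t + a * x)^3 = (a^3 - 27 * b) * x^3"
      using root by blast
    then have "((3 * b * t + a * x) / x)^3 = a^3 - 27 * b" by (simp add: power_divide)
    then show "\<exists>c. c^3 = a^3 - 27 * b" ..
  next
    assume "\<exists>c. c^3 = a^3 - 27 * b"
    then obtain c where c: "c^3 = a^3 - 27 * b" ..
    have "27 * b \<noteq> 0"
    proof -
      have "27 * b = 3 * 9 * b" by simp
      then show ?thesis using three nine \<open>b \<noteq> 0\<close> by (metis mult_eq_0_iff)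
    qed
    then have "c \<noteq> a" using c by auto
    define x where "x = 3 * b * t / (c - a)"
    have "x \<noteq> 0" using three \<open>b \<noteq> 0\<close> \<open>t \<noteq> 0\<close> \<open>c \<noteq> a\<close> by (simp add: x_def)
    moreover have "3 * b * t + a * x = c * x" using \<open>c \<noteq> a\<close> by (simp add: x_def field_simps)
    then have "(3 * b * t + a * x)^3 = (a^3 - 27 * b) * x^3" by (simp add: power_mult_distrib c)
    ultimately show "\<exists>x. x \<noteq> 0 \<and> three_division (twisted_curve t a b) x = 0" using root by blast
  qed
qed

lemma odd_power_twist_nonsquare:
  fixes t b :: "'k::field"
  assumes "\<nexists>s. s^2 = t" "b \<noteq> 0"
  shows "\<nexists>s. s^2 = t^3 * b^2"
proof
  have t: "t \<noteq> 0" using assms(1) by (metis zero_power2)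
  assume "\<exists>s. s^2 = t^3 * b^2"
  then obtain s where "s^2 = t^3 * b^2" ..
  then have "(s / (t * b))^2 = t"
    using t assms(2) by (simp add: field_simps power2_eq_square power3_eq_cube)
  then show False using assms(1) by blast
qed

lemma Collect_eq_singleton_iff:
  assumes "P y"
  shows "{z. P z} = {x} \<longleftrightarrow> x = y \<and> \<not> (\<exists>z. z \<noteq> y \<and> P z)"
  using assms by (auto simp: set_eq_iff)

lemma twisted_curve_special_iff:
  fixes t a b :: "'a::{field,finite}"
  assumes two: "(2::'a) \<noteq> 0" and three: "(3::'a) \<noteq> 0" and t: "\<nexists>s. s^2 = t"
  shows "twisted_curve t a b \<in> special_curves \<longleftrightarrow> b \<noteq> 0 \<and> (\<nexists>c. c^3 = a^3 - 27 * b)"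
proof (cases "b = 0")
  case True
  then show ?thesis
    by (simp add: special_curves_def elliptic_twisted_curve[OF two])
next
  case False
  let ?E = "twisted_curve t a b"
  have "t \<noteq> 0" using t by (metis zero_power2)
  have "three_division ?E 0 = 0" by (simp add: three_division_twisted_curve[OF two])
  then have "{x. three_division ?E x = 0} = {x} \<longleftrightarrow>
      x = 0 \<and> \<not> (\<exists>x. x \<noteq> 0 \<and> three_division ?E x = 0)" for x
    by (rule Collect_eq_singleton_iff)
  then have "{x. three_division ?E x = 0} = {x} \<longleftrightarrow> x = 0 \<and> (\<nexists>c. c^3 = a^3 - 27 * b)" for x
    by (simp only: three_division_twisted_curve_root_iff[OF two three \<open>t \<noteq> 0\<close> False])
  moreover have "\<nexists>s. s^2 = two_division ?E 0"
    unfolding two_division_twisted_curve[OF two] by (rule odd_power_twist_nonsquare[OF t False])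
  moreover have "elliptic_curve ?E" if "\<nexists>c. c^3 = a^3 - 27 * b"
  proof -
    \<comment> \<open>Zero is a cube, so being a noncube already gives nonsingularity.\<close>
    have "a^3 - 27 * b \<noteq> 0" using that[simplified, rule_format, of 0] by simp
    then show ?thesis using \<open>t \<noteq> 0\<close> False by (simp add: elliptic_twisted_curve[OF two])
  qed
  ultimately show ?thesis using False by (simp add: special_curves_iff[OF two]) blast
qed

text \<open>The translation by \<open>- t * a^2 / 12\<close>, minus a third of the
  \<open>x^2\<close> coefficient, removes that coefficient. The factors 48 and 864 clear the
  denominators, which are products of 2 and 3.\<close>

lemma change_of_variables_representative:
  fixes t a b0 :: "'k::field"
  assumes two: "(2::'k) \<noteq> 0" and three: "(3::'k) \<noteq> 0"
  shows "change_of_variables 1 (- (t * a^2 / 12)) 0 0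
    (twisted_curve t a (b0^i)) (representative b0 t i a)"
proof -
  define b where "b = b0^i"
  have "(12::'k) = 2 * 2 * 3" "(48::'k) = 2 * 2 * 2 * 2 * 3" "(24::'k) = 2 * 2 * 2 * 3"
    "(864::'k) = 2 * 2 * 2 * 2 * 2 * 3 * 3 * 3" "(4::'k) = 2 * 2" by simp_all
  then have nz: "(12::'k) \<noteq> 0" "(48::'k) \<noteq> 0" "(24::'k) \<noteq> 0" "(864::'k) \<noteq> 0" "(4::'k) \<noteq> 0"
    using two three by (metis mult_eq_0_iff)+
  define k A B C where "k = t * a^2 / 12" and "A = t * a^2 / 4"
    and "B = t^2 * a * b / 2" and "C = t^3 * b^2 / 4"
  have ABC: "12 * k = t * a^2" "4 * A = t * a^2" "2 * B = t^2 * a * b" "4 * C = t^3 * b^2"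
    using two nz by (simp_all add: k_def A_def B_def C_def)
  have "4 * A = 4 * (3 * k)" using ABC by simp
  then have A: "A = 3 * k" using nz by (simp only: mult_cancel_left) simp
  have "48 * coeff_A a b = - (a * (a^3 - 24 * b))" using nz by (simp add: coeff_A_def)
  then have "48 * (t^2 * coeff_A a b) = t^2 * - (a * (a^3 - 24 * b))"
    by (simp only: mult.left_commute)
  also have "\<dots> = 24 * (2 * B) - (12 * k)^2" unfolding ABC by Groebner_Basis.algebra
  also have "\<dots> = 48 * (B + 2 * - k * A + 3 * (- k)^2)" unfolding A by Groebner_Basis.algebra
  finally have 4: "t^2 * coeff_A a b = B + 2 * - k * A + 3 * (- k)^2"
    using nz by (simp only: mult_cancel_left) simp
  have mult_div: "4 * (z / 4) = z" "24 * (z / 24) = z" "864 * (z / 864) = z" for z :: 'k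
    using nz by (simp_all only: times_divide_eq_right nonzero_mult_div_cancel_left not_False_eq_True)
  have "864 * (x + y - z) = 216 * (4 * x) + 864 * y - 36 * (24 * z)" for x y z :: 'k
    by Groebner_Basis.algebra
  then have "864 * coeff_B a b = 216 * b^2 + a^6 - 36 * (a^3 * b)"
    unfolding coeff_B_def by (simp only: mult_div)
  then have "864 * (t^3 * coeff_B a b) = t^3 * (216 * b^2 + a^6 - 36 * (a^3 * b))"
    by (simp only: mult.left_commute)
  also have "\<dots> = 216 * (4 * C) - 36 * (12 * k) * (2 * B) + (12 * k)^3"
    unfolding ABC by Groebner_Basis.algebra
  also have "\<dots> = 864 * (C + - k * B + (- k)^2 * A + (- k)^3)"
    unfolding A by Groebner_Basis.algebra
  finally have 6: "t^3 * coeff_B a b = C + - k * B + (- k)^2 * A + (- k)^3"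
    using nz by (simp only: mult_cancel_left) simp
  show ?thesis
    unfolding twisted_curve_def representative_def b_def[symmetric] change_of_variables.simps
      k_def[symmetric] A_def[symmetric] B_def[symmetric] C_def[symmetric]
    using 4 6 by (simp add: A)
qed

lemma elliptic_representative_iff:
  fixes t a b0 :: "'k::field"
  assumes two: "(2::'k) \<noteq> 0" and three: "(3::'k) \<noteq> 0"
  shows "elliptic_curve (representative b0 t i a) \<longleftrightarrow> t \<noteq> 0 \<and> b0^i \<noteq> 0 \<and> a^3 \<noteq> 27 * b0^i"
  using change_of_variables_elliptic[OF two one_neq_zero change_of_variables_representative[OF two three]]
    elliptic_twisted_curve[OF two] by metis

lemma representative_isomorphic:
  fixes t a b0 :: "'k::field"
  assumes two: "(2::'k) \<noteq> 0" and three: "(3::'k) \<noteq> 0"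
    and "elliptic_curve (representative b0 t i a)"
  shows "(twisted_curve t a (b0^i), representative b0 t i a) \<in> curve_isomorphism"
  using assms(3) change_of_variables_representative[OF two three, of t a b0 i] one_neq_zero
    change_of_variables_elliptic[OF two one_neq_zero change_of_variables_representative[OF two three]]
  unfolding curve_isomorphism_def by blast

text \<open>The target has b4 = \<open>t^2 * a * b\<close> and b6 = \<open>t^3 * b^2\<close> at the
  origin; matching them with \<open>h\<close> and \<open>t * e^2\<close> gives
  \<open>b = e / t\<close> and \<open>a = h / (t * e)\<close>. The remaining condition b2 =
  \<open>t * a^2\<close> is the three-division equation. The choice of \<open>s\<close> and
  \<open>w\<close> removes the \<open>x y\<close> and \<open>y\<close> terms.\<close>

lemma change_of_variables_twisted_curve:
  fixes E :: "'k::field weierstrass"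
  assumes two: "(2::'k) \<noteq> 0" and x: "three_division E x = 0"
    and e: "two_division E x = t * e^2" and nz: "t \<noteq> 0" "e \<noteq> 0"
  obtains s w a b where "change_of_variables 1 x s w E (twisted_curve t a b)" "b \<noteq> 0"
proof -
  obtain a1 a2 a3 a4 a6 where E: "E = Weierstrass a1 a2 a3 a4 a6" by (cases E)
  define h where "h = two_division_d1 E x"
  define a where "a = h / (t * e)"
  define b where "b = e / t"
  have four: "(4::'k) \<noteq> 0" by (rule four_nonzero[OF two])
  have "two_division_d2 E x * (t * e^2) = h^2"
    using four_three_division[of E x] x e by (simp add: h_def)
  then have slope: "t * a^2 = two_division_d2 E x"
    using nz by (simp add: a_def field_simps power2_eq_square)
  have deriv: "t^2 * a * b = h" using nz by (simp add: a_def b_def field_simps power2_eq_square)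
  have two_div: "t^3 * b^2 = two_division E x"
    unfolding e using nz by (simp add: b_def field_simps power2_eq_square power3_eq_cube)
  have half: "2 * (z / 2) = z" "4 * (z / 4) = z" for z :: 'k using two four by simp_all
  have cancel: "y = z" if "4 * y = 4 * z" for y z :: 'k using that four by simp
  have cancel2: "y = z" if "2 * y = 2 * z" for y z :: 'k using that two by simp
  define s where "s = - a1 / 2"
  define w where "w = - (a3 + x * a1) / 2"
  have s: "2 * s = - a1" and w: "2 * w = - (a3 + x * a1)" using two by (simp_all add: s_def w_def)
  have "t * a^2 / 4 = a2 - s * a1 + 3 * x - s^2"
    by (rule cancel, unfold half slope E two_division_d2.simps) (use s in Groebner_Basis.algebra)
  moreover have "t^2 * a * b / 2 = a4 - s * a3 + 2 * x * a2 - (w + x * s) * a1 + 3 * x^2 - 2 * s * w"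
    by (rule cancel2, unfold half deriv h_def E two_division_d1.simps)
      (use s w in Groebner_Basis.algebra)
  moreover have "t^3 * b^2 / 4 = a6 + x * a4 + x^2 * a2 + x^3 - w * a3 - w^2 - x * w * a1"
    by (rule cancel, unfold half two_div E two_division.simps) (use w in Groebner_Basis.algebra)
  ultimately have "change_of_variables 1 x s w E (twisted_curve t a b)"
    unfolding E twisted_curve_def change_of_variables.simps using s w by simp
  moreover have "b \<noteq> 0" using nz by (simp add: b_def)
  ultimately show ?thesis by (rule that)
qed

lemma change_of_variables_scale_twisted_curve:
  fixes t a b :: "'k::field"
  assumes two: "(2::'k) \<noteq> 0" and u: "u \<noteq> 0"
  shows "change_of_variables u 0 0 0 (twisted_curve t (u * a) (u^3 * b)) (twisted_curve t a b)"
  using two four_nonzero[OF two]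
  by (simp add: twisted_curve_def field_simps power2_eq_square power3_eq_cube eval_nat_numeral)

text \<open>
  The translation part of the isomorphism sends the root \<open>0\<close> of one three-division polynomial to a
  root of the other, hence to \<open>0\<close>.
\<close>

lemma twisted_curve_isomorphicD:
  fixes t a b :: "'a::{field,finite}"
  assumes two: "(2::'a) \<noteq> 0" and special: "twisted_curve t a b \<in> special_curves"
    and iso: "(twisted_curve t a b, twisted_curve t c d) \<in> curve_isomorphism"
  obtains u where "u \<noteq> 0" "u^2 * c^2 = a^2" "u^4 * (c * d) = a * b" "u^6 * d^2 = b^2"
proof -
  obtain u r s w where u: "u \<noteq> 0"
      and cov: "change_of_variables u r s w (twisted_curve t a b) (twisted_curve t c d)"
      and ell: "elliptic_curve (twisted_curve t a b)"
    using iso by (auto simp: curve_isomorphism_def)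
  have t: "t \<noteq> 0" using ell elliptic_twisted_curve[OF two] by blast
  obtain x where x: "{x. three_division (twisted_curve t a b) x = 0} = {x}"
    using special special_curves_iff[OF two] by blast
  have 1: "three_division (twisted_curve t a b) (u^2 * 0 + r) = 0"
    unfolding change_of_variables_three_division[OF two cov, symmetric]
    by (simp add: three_division_twisted_curve[OF two])
  have 2: "three_division (twisted_curve t a b) 0 = 0"
    by (simp add: three_division_twisted_curve[OF two])
  have "u^2 * 0 + r \<in> {x}" "0 \<in> {x}" unfolding x[symmetric] using 1 2 by simp_all
  then have r: "r = 0" by simp
  note eqs = change_of_variablesD[OF cov[unfolded twisted_curve_def]]
  have s: "s = 0" using eqs(1) two by simp
  have w: "w = 0" using eqs(3) two r by simp
  have "u^2 * c^2 = a^2" using eqs(2) four_nonzero[OF two] t by (simp add: r s w field_simps)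
  moreover have "u^4 * (c * d) = a * b" using eqs(4) two t by (simp add: r s w field_simps)
  moreover have "u^6 * d^2 = b^2" using eqs(5) four_nonzero[OF two] t by (simp add: r s w field_simps)
  ultimately show ?thesis using u that by blast
qed

section \<open>Cubic characters and the count\<close>

text \<open>Each value of \<open>x^n\<close> is taken at most \<open>n\<close> times; this bounds
  the number of squares and of cubes from below.\<close>

lemma card_nonzero_le_card_powers:
  assumes "0 < n"
  shows "card (UNIV - {0 :: 'a::{field,finite}}) \<le> n * card ((\<lambda>x :: 'a. x ^ n) ` (UNIV - {0}))"
proof -
  let ?U = "UNIV - {0 :: 'a}"
  let ?C = "(\<lambda>x :: 'a. x ^ n) ` ?U"
  have roots: "card {x :: 'a. x ^ n = c} \<le> n" for c
  proof -
    let ?p = "Polynomial.monom 1 n - [:c:]"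
    have "Polynomial.coeff ?p n \<noteq> 0" using assms by (simp add: coeff_pCons split: nat.split)
    then have "?p \<noteq> 0" by (metis coeff_0)
    moreover have "Polynomial.degree ?p \<le> n"
      by (intro degree_diff_le degree_monom_le) simp
    moreover have "{x. poly ?p x = 0} = {x. x ^ n = c}" by (simp add: poly_monom)
    ultimately show ?thesis using card_poly_roots_bound[of ?p] by simp
  qed
  have "card ?U \<le> card (\<Union>c\<in>?C. {x. x ^ n = c})" by (intro card_mono) auto
  also have "\<dots> \<le> (\<Sum>c\<in>?C. card {x. x ^ n = c})" by (intro card_UN_le) simp
  also have "\<dots> \<le> (\<Sum>c\<in>?C. n)" by (intro sum_mono roots)
  finally show ?thesis by (simp add: mult.commute)
qed

text \<open>In characteristic 2 squaring is injective, hence onto a finite field.\<close>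

lemma two_nonzero_if_nonsquare:
  assumes "\<nexists>s. s^2 = (t :: 'a::{field,finite})"
  shows "(2 :: 'a) \<noteq> 0"
proof
  assume two: "(2 :: 'a) = 0"
  have "inj (\<lambda>x :: 'a. x^2)"
  proof (rule injI)
    fix x y :: 'a
    assume "x^2 = y^2"
    moreover have "(x - y)^2 = x^2 - y^2 + 2 * (y^2 - x * y)" by Groebner_Basis.algebra
    ultimately show "x = y" using two by simp
  qed
  then have "surj (\<lambda>x :: 'a. x^2)" by (rule finite_UNIV_inj_surj[OF finite])
  then show False using assms by (metis surjD)
qed

text \<open>The nonzero squares and their multiples by \<open>t\<close> are disjoint, and each set
  holds at least half of the nonzero elements, so no nonsquare is left over.\<close>

lemma nonsquare_ratio:
  fixes t d :: "'a::{field,finite}"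
  assumes t: "\<nexists>s. s^2 = t" and d: "\<nexists>s. s^2 = d"
  obtains e where "d = t * e^2" "e \<noteq> 0"
proof -
  have nz: "t \<noteq> 0" "d \<noteq> 0" using t d by (metis zero_power2)+
  let ?U = "UNIV - {0 :: 'a}"
  let ?S = "(\<lambda>x :: 'a. x^2) ` ?U"
  have "d \<in> (*) t ` ?S"
  proof (rule ccontr)
    assume notin: "d \<notin> (*) t ` ?S"
    have "?S \<inter> (*) t ` ?S = {}"
    proof (rule ccontr)
      assume "?S \<inter> (*) t ` ?S \<noteq> {}"
      then obtain x y where "y \<noteq> 0" "x^2 = t * y^2" by auto
      then have "(x / y)^2 = t" by (simp add: power_divide)
      then show False using t by blast
    qed
    then have "card (?S \<union> (*) t ` ?S) = card ?S + card ?S"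
      using nz by (simp add: card_Un_disjoint card_image inj_on_def)
    moreover have "d \<notin> ?S \<union> (*) t ` ?S" using notin d by auto
    ultimately have "card (insert d (?S \<union> (*) t ` ?S)) = Suc (2 * card ?S)" by simp
    moreover have "card (insert d (?S \<union> (*) t ` ?S)) \<le> card ?U"
      using nz by (intro card_mono) auto
    ultimately show False using card_nonzero_le_card_powers[of 2, where 'a = 'a] by simp
  qed
  then show ?thesis using that nz by auto
qed

text \<open>It allows isomorphism classes to be counted through the invariants
  \<open>(i, a^3)\<close> of their representatives.\<close>

lemma card_image_eq_if_same_kernel:
  assumes "\<And>x y. x \<in> A \<Longrightarrow> y \<in> A \<Longrightarrow> f x = f y \<longleftrightarrow> g x = g y"
  shows "card (f ` A) = card (g ` A)"
proof -
  define h where "h z = g (SOME x. x \<in> A \<and> f x = z)" for z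
  have h: "h (f x) = g x" if "x \<in> A" for x
  proof -
    have "(SOME y. y \<in> A \<and> f y = f x) \<in> A \<and> f (SOME y. y \<in> A \<and> f y = f x) = f x"
      by (rule someI[of _ x]) (simp add: that)
    then show ?thesis unfolding h_def using assms that by blast
  qed
  then have "g ` A = h ` f ` A" by (auto simp: image_iff)
  moreover have "inj_on h (f ` A)" using h assms by (auto simp: inj_on_def)
  ultimately show ?thesis by (simp add: card_image)
qed

section \<open>The values and the kernel of the cubic character\<close>

context
  fixes \<chi> :: "'a::{field,finite} \<Rightarrow> complex" and \<rho> :: complex and b0 :: 'a
  assumes chi: "cubic_character \<chi>" and rho3: "\<rho> ^ 3 = 1" and rho1: "\<rho> \<noteq> 1" and chi_b0: "\<chi> b0 = \<rho>"
begin

lemma chi_mult: "\<chi> (x * y) = \<chi> x * \<chi> y"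
  and chi_0: "\<chi> 0 = 0"
  and chi_cubed: "x \<noteq> 0 \<Longrightarrow> \<chi> x ^ 3 = 1"
  using chi unfolding cubic_character_def by blast+

lemma chi_eq_0_iff: "\<chi> x = 0 \<longleftrightarrow> x = 0"
  using chi_0 chi_cubed[of x] by (metis zero_neq_one zero_power zero_less_numeral)

lemma chi_1: "\<chi> 1 = 1"
  using chi_mult[of 1 1] chi_eq_0_iff[of 1] by simp

lemma chi_power: "\<chi> (x ^ n) = \<chi> x ^ n"
  by (induction n) (simp_all add: chi_1 chi_mult)

lemma chi_divide: "\<chi> (x / y) = \<chi> x / \<chi> y"
\<comment> \<open>For \<open>y = 0\<close> both sides are 0, by \<open>x / 0 = 0\<close> and
  \<open>\<chi> 0 = 0\<close>.\<close>
proof (cases "y = 0")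
  case False
  then have "\<chi> (x / y) * \<chi> y = \<chi> x" by (simp flip: chi_mult)
  then show ?thesis using chi_eq_0_iff[of y] False by (simp add: eq_divide_eq)
qed (simp add: chi_0)

lemma rho_nonzero: "\<rho> \<noteq> 0"
  using rho3 by auto

lemma b0_nonzero: "b0 \<noteq> 0"
  using chi_b0 chi_0 rho_nonzero by auto

lemma rho_power_inj:
  assumes "i \<in> {0, 1, 2}" "j \<in> {0, 1, 2}" "\<rho> ^ i = \<rho> ^ j"
  shows "i = (j::nat)"
proof -
  have "\<rho>^2 \<noteq> 1"
  proof
    assume "\<rho>^2 = 1"
    moreover have "\<rho>^3 = \<rho>^2 * \<rho>" by (simp add: power2_eq_square power3_eq_cube)
    ultimately show False using rho3 rho1 by simp
  qed
  moreover have "\<rho>^2 \<noteq> \<rho>" using rho1 rho_nonzero by (simp add: power2_eq_square)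
  ultimately show ?thesis using assms rho1 by (auto dest: sym)
qed

lemma cube_root_of_unity_cases:
  assumes "z ^ 3 = 1"
  obtains i :: nat where "i \<in> {0, 1, 2}" "z = \<rho> ^ i"
proof -
  have "(\<rho> - 1) * (1 + \<rho> + \<rho>^2) = \<rho>^3 - 1" by Groebner_Basis.algebra
  then have rho: "1 + \<rho> + \<rho>^2 = 0" using rho3 rho1 by simp
  have "(z - 1) * (z - \<rho>) * (z - \<rho>^2) =
      z^3 - \<rho>^3 - z * (z - \<rho>) * (1 + \<rho> + \<rho>^2)" by Groebner_Basis.algebra
  also have "\<dots> = 0" using rho assms rho3 by simp
  finally have "z = \<rho>^0 \<or> z = \<rho>^1 \<or> z = \<rho>^2" by simp
  then show ?thesis using that by blast
qed

lemma chi_cases: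
  assumes "x \<noteq> 0"
  obtains i :: nat where "i \<in> {0, 1, 2}" "\<chi> x = \<rho> ^ i"
  using cube_root_of_unity_cases chi_cubed[OF assms] by blast

text \<open>Multiplication by \<open>b0^i\<close> carries the kernel onto the set where the
  character is \<open>\<rho>^i\<close>.\<close>

lemma card_nonzero_eq: "card (UNIV - {0 :: 'a}) = 3 * card {x. \<chi> x = 1}"
proof -
  define K where "K i = {x. \<chi> x = \<rho> ^ i}" for i :: nat
  have "bij_betw ((*) (b0 ^ i)) (K 0) (K i)" for i
    using b0_nonzero rho_nonzero
    by (intro bij_betw_byWitness[where f' = "\<lambda>x. x / b0 ^ i"])
      (auto simp: K_def chi_mult chi_divide chi_power chi_b0)
  then have card_K: "card (K i) = card (K 0)" for i by (metis bij_betw_same_card)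
  have disj: "K i \<inter> K j = {}" if "i \<in> {0, 1, 2}" "j \<in> {0, 1, 2}" "i \<noteq> j" for i j
    using rho_power_inj[OF that(1,2)] that(3) by (auto simp: K_def)
  have "UNIV - {0} = (\<Union>i\<in>{0, 1, 2}. K i)"
  proof (intro equalityI subsetI)
    fix x :: 'a assume "x \<in> UNIV - {0}"
    then have "x \<noteq> 0" by simp
    then obtain i :: nat where "i \<in> {0, 1, 2}" "\<chi> x = \<rho> ^ i" by (rule chi_cases)
    then show "x \<in> (\<Union>i\<in>{0, 1, 2}. K i)" unfolding K_def by blast
  next
    fix x assume "x \<in> (\<Union>i\<in>{0, 1, 2}. K i)"
    then show "x \<in> UNIV - {0}" using rho_nonzero chi_0 by (auto simp: K_def)
  qed
  also have "card \<dots> = (\<Sum>i\<in>{0, 1, 2}. card (K i))"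
    using disj by (intro card_UN_disjoint) auto
  also have "\<dots> = (\<Sum>i\<in>{0, 1, 2 :: nat}. card (K 0))" by (rule sum.cong[OF refl card_K])
  also have "\<dots> = 3 * card (K 0)" by simp
  finally show ?thesis by (simp add: K_def)
qed

text \<open>Nonzero cubes lie in the kernel. The kernel is exactly a third of the nonzero elements
  and the cubes are at least a third, so the two sets agree.\<close>

lemma chi_eq_1_iff: "\<chi> x = 1 \<longleftrightarrow> x \<noteq> 0 \<and> (\<exists>c. c ^ 3 = x)"
proof -
  have "(\<lambda>x. x ^ 3) ` (UNIV - {0}) = {x. \<chi> x = 1}"
  proof (rule card_seteq)
    show "(\<lambda>x. x ^ 3) ` (UNIV - {0}) \<subseteq> {x. \<chi> x = 1}"
      using chi_cubed by (auto simp: chi_power)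
    show "card {x. \<chi> x = 1} \<le> card ((\<lambda>x :: 'a. x ^ 3) ` (UNIV - {0}))"
      using card_nonzero_le_card_powers[of 3, where 'a = 'a] card_nonzero_eq by simp
  qed simp
  then have "\<chi> x = 1 \<longleftrightarrow> x \<in> (\<lambda>x. x ^ 3) ` (UNIV - {0})" by blast
  then show ?thesis by (auto simp: image_iff)
qed

text \<open>In characteristic 3 cubing is injective, hence onto, and \<open>b0\<close> would be a
  cube.\<close>

lemma three_nonzero: "(3 :: 'a) \<noteq> 0"
proof
  assume three: "(3 :: 'a) = 0"
  have "inj (\<lambda>x :: 'a. x^3)"
  proof (rule injI)
    fix x y :: 'a
    assume "x^3 = y^3"
    moreover have "(x - y)^3 = x^3 - y^3 + 3 * (x * y^2 - x^2 * y)" by Groebner_Basis.algebra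
    ultimately show "x = y" using three by simp
  qed
  then have "surj (\<lambda>x :: 'a. x^3)" by (rule finite_UNIV_inj_surj[OF finite])
  then obtain c where "b0 = c^3" by (rule surjE)
  then have "\<chi> b0 = 1" using b0_nonzero by (auto simp: chi_eq_1_iff)
  then show False using chi_b0 rho1 by simp
qed

text \<open>\<open>-1\<close> is a cube, so the character does not see signs. This serves the
  constant \<open>-27\<close> and the sign lost when a square root is taken.\<close>

lemma chi_minus_cube: "\<chi> (- (x ^ 3)) = 1" if "x \<noteq> 0"
  unfolding chi_eq_1_iff using that by (auto intro!: exI[of _ "- x"])

lemma card_noncubes: "3 * card {x. x \<noteq> 0 \<and> \<chi> x \<noteq> 1} = 2 * (CARD('a) - 1)"
proof -
  have "{x. x \<noteq> 0 \<and> \<chi> x \<noteq> 1} = (UNIV - {0}) - {x. \<chi> x = 1}" by auto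
  also have "card \<dots> = card (UNIV - {0 :: 'a}) - card {x. \<chi> x = 1}"
    using chi_0 by (intro card_Diff_subset) auto
  finally show ?thesis using card_nonzero_eq by (simp add: card_Diff_singleton_if)
qed

text \<open>For \<open>y \<noteq> 0\<close> the map \<open>1 - 27 * b0^i / y\<close> equals
  \<open>(y - 27 * b0^i) / y\<close> with \<open>y\<close> a cube, so it has the character value of
  the numerator. For \<open>y = 0\<close> that value is \<open>\<rho>^i\<close>, which admits
  \<open>i = 1\<close> and \<open>i = 2\<close>.\<close>

lemma card_index_pairs:
  "3 * card {(i, y). i \<in> {0, 1, 2 :: nat} \<and> (\<exists>a. a^3 = y) \<and> \<chi> (y - 27 * b0^i) \<noteq> 1 \<and> y \<noteq> 27 * b0^i}
    = 2 * CARD('a) + 4" (is "3 * card ?D = _")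
proof -
  define D where "D = ?D"
  have "(3 :: 'a)^3 = 27" by simp
  then have c27: "(27 :: 'a) \<noteq> 0" "\<chi> (- 27) = 1"
    using power_not_zero[OF three_nonzero, of 3] chi_minus_cube[OF three_nonzero] by simp_all
  let ?D' = "{(i, y). (i, y) \<in> D \<and> y \<noteq> 0}"
  let ?V = "{x. x \<noteq> 0 \<and> \<chi> x \<noteq> 1}"
  let ?f = "\<lambda>(i, y). 1 - 27 * b0 ^ i / y"
  have f: "\<chi> (?f (i, y)) = \<chi> (y - 27 * b0^i)" if "\<chi> y = 1" for i y
  proof -
    have "?f (i, y) = (y - 27 * b0^i) / y" using that chi_0 by (auto simp: diff_divide_distrib)
    then show ?thesis using that by (simp add: chi_divide)
  qed
  have "bij_betw ?f ?D' ?V"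
  proof (rule bij_betwI')
    fix p p' assume p: "p \<in> ?D'" "p' \<in> ?D'"
    obtain i y j z where ij: "p = (i, y)" "p' = (j, z)" by (cases p; cases p')
    have y: "\<chi> y = 1" "\<chi> z = 1" "y \<noteq> 0" "z \<noteq> 0" and i: "i \<in> {0, 1, 2}" "j \<in> {0, 1, 2}"
      using p by (auto simp: ij D_def chi_eq_1_iff)
    show "?f p = ?f p' \<longleftrightarrow> p = p'"
    proof
      assume "?f p = ?f p'"
      then have "27 * (b0^i / y) = 27 * (b0^j / z)" by (simp add: ij)
      then have eq: "b0^i / y = b0^j / z" using c27(1) by (simp only: mult_cancel_left) simp
      then have "\<chi> (b0^i / y) = \<chi> (b0^j / z)" by simp
      then have "\<rho>^i = \<rho>^j" by (simp add: chi_divide chi_power chi_b0 y)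
      then have "i = j" by (rule rho_power_inj[OF i])
      then show "p = p'" using eq b0_nonzero y by (simp add: ij divide_simps)
    qed simp
  next
    fix p assume p: "p \<in> ?D'"
    obtain i y where ij: "p = (i, y)" by (cases p)
    have y: "\<chi> y = 1" "y \<noteq> 0" using p by (auto simp: ij D_def chi_eq_1_iff)
    have "?f p \<noteq> 0" using p y by (simp add: ij D_def divide_simps)
    moreover have "\<chi> (?f p) \<noteq> 1" using p f[OF y(1)] by (simp add: ij D_def)
    ultimately show "?f p \<in> ?V" by simp
  next
    fix v assume v: "v \<in> ?V"
    then have "v \<noteq> 1" using chi_1 by auto
    define z where "z = (1 - v) / 27"
    have "27 * z = 1 - v"
      unfolding z_def times_divide_eq_right by (rule nonzero_mult_div_cancel_left[OF c27(1)])
    then have z: "z \<noteq> 0" "1 - 27 * z = v" using \<open>v \<noteq> 1\<close> by auto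
    obtain i :: nat where i: "i \<in> {0, 1, 2}" "\<chi> z = \<rho> ^ i" using z(1) by (rule chi_cases)
    \<comment> \<open>Taking \<open>i\<close> from the class of \<open>z\<close> makes
      \<open>b0^i / z\<close> a cube; it is the only choice of \<open>y\<close> with
      \<open>27 * b0^i / y = 1 - v\<close>.\<close>
    define y where "y = b0^i / z"
    have "\<chi> y = 1" by (simp add: y_def chi_divide chi_power chi_b0 i rho_nonzero)
    then have y: "y \<noteq> 0" "\<exists>a. a^3 = y" by (simp_all add: chi_eq_1_iff)
    have fv: "?f (i, y) = v" using z b0_nonzero by (simp add: y_def)
    then have "\<chi> (y - 27 * b0^i) \<noteq> 1" using v f[OF \<open>\<chi> y = 1\<close>, of i] by simp
    moreover have "y \<noteq> 27 * b0^i" using fv v y by auto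
    ultimately have "(i, y) \<in> ?D'" using i y by (simp add: D_def)
    then show "\<exists>p\<in>?D'. v = ?f p" using fv by blast
  qed
  then have card_D': "card ?D' = card ?V" by (rule bij_betw_same_card)
  have "\<chi> (- (27 * b0^i)) = \<rho>^i" for i
    using chi_mult[of "- 27" "b0^i"] c27 by (simp add: chi_power chi_b0)
  moreover have "\<rho>^2 \<noteq> 1" using rho_power_inj[of 2 0] by auto
  ultimately have D0: "(i, 0) \<in> D \<longleftrightarrow> i = 1 \<or> i = 2" for i
    using rho1 c27 b0_nonzero by (auto simp: D_def intro: exI[of _ 0])
  have "p \<in> D \<longleftrightarrow> p \<in> {(1, 0), (2, 0)} \<union> ?D'" for p
    using D0[of "fst p"] by (cases p; cases "snd p = 0") auto
  then have "D = {(1, 0), (2, 0)} \<union> ?D'" by blast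
  also have "card \<dots> = 2 + card ?D'"
  proof (subst card_Un_disjoint)
    show "finite ?D'" by (rule finite_subset[of _ "{0, 1, 2} \<times> UNIV"]) (auto simp: D_def)
  qed auto
  finally have "3 * card D = 6 + 2 * (CARD('a) - 1)" using card_noncubes by (simp add: card_D')
  moreover have "1 \<le> CARD('a)" by (simp add: Suc_le_eq)
  ultimately show ?thesis unfolding D_def by linarith
qed

section \<open>Isomorphism classes of the twisted family\<close>

context
  fixes t :: 'a
  assumes t: "\<nexists>s. s^2 = t"
begin

lemmas two = two_nonzero_if_nonsquare[OF t]

lemma t_nonzero: "t \<noteq> 0"
  using t by (metis zero_power2)

lemma representative_indices_iff:
  "(i, a) \<in> representative_indices \<chi> b0 t \<longleftrightarrow>
    i \<in> {0, 1, 2} \<and> \<chi> (a^3 - 27 * b0^i) \<noteq> 1 \<and> a^3 \<noteq> 27 * b0^i"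
  by (simp add: representative_indices_def elliptic_representative_iff[OF two three_nonzero]
      t_nonzero b0_nonzero)

lemma twisted_curve_special:
  assumes "(i, a) \<in> representative_indices \<chi> b0 t"
  shows "twisted_curve t a (b0^i) \<in> special_curves"
  using assms unfolding twisted_curve_special_iff[OF two three_nonzero t] representative_indices_iff
  by (auto simp: chi_eq_1_iff b0_nonzero)

lemma twisted_curve_isomorphic_representative:
  assumes "(i, a) \<in> representative_indices \<chi> b0 t"
  shows "(twisted_curve t a (b0^i), representative b0 t i a) \<in> curve_isomorphism"
  using assms representative_isomorphic[OF two three_nonzero]
  by (simp add: representative_indices_def)

lemma representative_special:
  assumes "(i, a) \<in> representative_indices \<chi> b0 t"
  shows "representative b0 t i a \<in> special_curves"
  using special_curves_isomorphic[OF two] twisted_curve_special twisted_curve_isomorphic_representative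
    assms by blast

lemma curve_isomorphism_sym: "(E, E') \<in> curve_isomorphism \<Longrightarrow> (E', E) \<in> curve_isomorphism"
  for E E' :: "'a weierstrass"
  using equiv_curve_isomorphism[where 'a = 'a] unfolding equiv_def by (blast dest: symD)

lemma curve_isomorphism_trans:
  "(E, E') \<in> curve_isomorphism \<Longrightarrow> (E', E'') \<in> curve_isomorphism \<Longrightarrow> (E, E'') \<in> curve_isomorphism"
  for E E' E'' :: "'a weierstrass"
  using equiv_curve_isomorphism[where 'a = 'a] unfolding equiv_def by (blast dest: transD)

lemma special_curve_isomorphic_representative:
  assumes E: "E \<in> special_curves"
  obtains i a where "(i, a) \<in> representative_indices \<chi> b0 t"
    "(E, representative b0 t i a) \<in> curve_isomorphism"
proof -
  have ell: "elliptic_curve E" using E by (simp add: special_curves_def)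
  obtain x where x: "{x. three_division E x = 0} = {x}" and ns: "\<nexists>s. s^2 = two_division E x"
    using E special_curves_iff[OF two] by blast
  obtain e where e: "two_division E x = t * e^2" "e \<noteq> 0" by (rule nonsquare_ratio[OF t ns])
  have "three_division E x = 0" using x by blast
  then obtain s w a b where cov: "change_of_variables 1 x s w E (twisted_curve t a b)" and "b \<noteq> 0"
    by (rule change_of_variables_twisted_curve[OF two _ e(1) t_nonzero e(2)])
  obtain i :: nat where i: "i \<in> {0, 1, 2}" "\<chi> b = \<rho> ^ i" using \<open>b \<noteq> 0\<close> by (rule chi_cases)
  \<comment> \<open>Dividing by the right power of \<open>b0\<close> leaves a cube
    \<open>u^3\<close>, and scaling by \<open>u\<close> absorbs it.\<close>
  have "\<chi> (b / b0^i) = 1" by (simp add: chi_divide chi_power chi_b0 i rho_nonzero)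
  then obtain u where u: "u ^ 3 = b / b0^i" and "b / b0^i \<noteq> 0" by (auto simp: chi_eq_1_iff)
  then have "u \<noteq> 0" by auto
  have b: "b = u^3 * b0^i" and a: "a = u * (a / u)" using u b0_nonzero \<open>u \<noteq> 0\<close> by simp_all
  let ?E' = "twisted_curve t (a / u) (b0^i)"
  have "change_of_variables u 0 0 0 (twisted_curve t a b) ?E'"
    using change_of_variables_scale_twisted_curve[OF two \<open>u \<noteq> 0\<close>, of t "a / u" "b0^i"] a b by simp
  note cov' = change_of_variables_compose[OF cov this]
  have "1 * u \<noteq> 0" using \<open>u \<noteq> 0\<close> by simp
  then have "elliptic_curve ?E'" using change_of_variables_elliptic[OF two _ cov'] ell by blast
  then have iso: "(E, ?E') \<in> curve_isomorphism"
    unfolding curve_isomorphism_def using ell cov' \<open>1 * u \<noteq> 0\<close> by blast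
  then have "?E' \<in> special_curves" using special_curves_isomorphic[OF two E] by blast
  then have nocube: "\<nexists>c. c^3 = (a / u)^3 - 27 * b0^i"
    using twisted_curve_special_iff[OF two three_nonzero t] by blast
  then have "(a / u)^3 - 27 * b0^i \<noteq> 0" using zero_power[of 3] by (metis zero_less_numeral)
  then have index: "(i, a / u) \<in> representative_indices \<chi> b0 t"
    using i nocube by (simp add: representative_indices_iff chi_eq_1_iff)
  show ?thesis
    by (rule that[OF index])
      (rule curve_isomorphism_trans[OF iso twisted_curve_isomorphic_representative[OF index]])
qed

text \<open>Comparing coefficients leaves \<open>b0^i\<close> and \<open>u^3 * b0^j\<close> equal up
  to sign, which the character ignores; so \<open>i = j\<close> and \<open>u^6 = 1\<close>. Then
  \<open>a = u^4 * c\<close> gives \<open>a^3 = u^12 * c^3 = c^3\<close>. Conversely,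
  \<open>a / c\<close> is a cube root of unity and serves as scaling factor.\<close>

lemma representatives_isomorphic_iff:
  assumes ia: "(i, a) \<in> representative_indices \<chi> b0 t" and jc: "(j, c) \<in> representative_indices \<chi> b0 t"
  shows "(representative b0 t i a, representative b0 t j c) \<in> curve_isomorphism \<longleftrightarrow> i = j \<and> a^3 = c^3"
proof -
  let ?E = "twisted_curve t a (b0^i)" and ?E' = "twisted_curve t c (b0^j)"
  have ij: "i \<in> {0, 1, 2}" "j \<in> {0, 1, 2}" using ia jc by (simp_all add: representative_indices_iff)
  have "(representative b0 t i a, representative b0 t j c) \<in> curve_isomorphism \<longleftrightarrow>
      (?E, ?E') \<in> curve_isomorphism"
    using twisted_curve_isomorphic_representative[OF ia] twisted_curve_isomorphic_representative[OF jc]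
      curve_isomorphism_sym curve_isomorphism_trans by metis
  also have "\<dots> \<longleftrightarrow> i = j \<and> a^3 = c^3"
  proof
    assume "(?E, ?E') \<in> curve_isomorphism"
    then obtain u where u: "u \<noteq> 0" and a4: "u^4 * (c * b0^j) = a * b0^i"
        and a6: "u^6 * (b0^j)^2 = (b0^i)^2"
      by (rule twisted_curve_isomorphicD[OF two twisted_curve_special[OF ia]])
    have "(u^3 * b0^j)^2 = (b0^i)^2"
      using a6 by (simp add: power_mult_distrib flip: power_mult)
    then have b: "b0^i = u^3 * b0^j \<or> b0^i = - (u^3) * b0^j" by (auto simp: power2_eq_iff)
    have "\<chi> (u^3) = 1" "\<chi> (- (u^3)) = 1"
      using u chi_minus_cube[OF u] by (auto simp: chi_eq_1_iff)
    then have "\<chi> (b0^i) = \<chi> (b0^j)" using b by (metis chi_mult mult_1)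
    then have "i = j" using rho_power_inj[OF ij] by (simp add: chi_power chi_b0)
    moreover have "u^6 = 1" using a6 b0_nonzero \<open>i = j\<close> by simp
    then have "(u^6)^2 = 1" by simp
    moreover have "u^4 * c = a" using a4 b0_nonzero \<open>i = j\<close> by simp
    then have "a^3 = (u^6)^2 * c^3" by (auto simp: power_mult_distrib simp flip: power_mult)
    ultimately show "i = j \<and> a^3 = c^3" by simp
  next
    assume eq: "i = j \<and> a^3 = c^3"
    have ell: "elliptic_curve ?E" "elliptic_curve ?E'"
      using twisted_curve_special ia jc by (auto simp: special_curves_def)
    obtain u where u: "u^3 = 1" "a = u * c"
    proof (cases "c = 0")
      case True
      then have "a = 1 * c" using eq by simp
      then show ?thesis using that[of 1] by simp
    next
      case False
      then have "(a / c)^3 = 1" "a = (a / c) * c" using eq by (simp_all add: power_divide)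
      then show ?thesis by (rule that)
    qed
    have "u \<noteq> 0" using u by auto
    have "change_of_variables u 0 0 0 (twisted_curve t (u * c) (u^3 * b0^i)) (twisted_curve t c (b0^i))"
      by (rule change_of_variables_scale_twisted_curve[OF two \<open>u \<noteq> 0\<close>])
    then have "change_of_variables u 0 0 0 ?E ?E'" using u eq by simp
    then show "(?E, ?E') \<in> curve_isomorphism"
      using ell \<open>u \<noteq> 0\<close> unfolding curve_isomorphism_def by blast
  qed
  finally show ?thesis .
qed

text \<open>The index set is mapped both to classes and to pairs \<open>(i, a^3)\<close>. The two
  maps identify the same indices, so their images have equal size.\<close>

lemma card_special_curves_quotient:
  "3 * card ((special_curves :: 'a weierstrass set) // curve_isomorphism) = 2 * CARD('a) + 4"
proof -
  let ?I = "representative_indices \<chi> b0 t"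
  let ?F = "\<lambda>(i, a). curve_isomorphism `` {representative b0 t i a}"
  let ?G = "\<lambda>(i, a). (i, a^3)"
  note eq_class = eq_equiv_class_iff[OF equiv_curve_isomorphism]
  have ell: "elliptic_curve E" if "E \<in> special_curves" for E :: "'a weierstrass"
    using that by (simp add: special_curves_def)
  have "special_curves // curve_isomorphism = ?F ` ?I"
  proof (intro equalityI subsetI)
    fix C assume "C \<in> special_curves // (curve_isomorphism :: ('a weierstrass \<times> _) set)"
    then obtain E where E: "E \<in> special_curves" "C = curve_isomorphism `` {E}" by (rule quotientE)
    obtain i a where ia: "(i, a) \<in> ?I" "(E, representative b0 t i a) \<in> curve_isomorphism"
      by (rule special_curve_isomorphic_representative[OF E(1)])
    have "C = ?F (i, a)"
      using ia(2) equiv_class_eq[OF equiv_curve_isomorphism] by (simp add: E(2))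
    then show "C \<in> ?F ` ?I" using ia(1) by blast
  next
    fix C assume "C \<in> ?F ` ?I"
    then show "C \<in> special_curves // curve_isomorphism"
      using representative_special by (auto intro!: quotientI)
  qed
  moreover have "card (?F ` ?I) = card (?G ` ?I)"
  proof -
    have "?F p = ?F q \<longleftrightarrow> ?G p = ?G q" if "p \<in> ?I" "q \<in> ?I" for p q
    proof -
      obtain i a j c where pq: "p = (i, a)" "q = (j, c)" by (cases p; cases q)
      have "?F p = ?F q \<longleftrightarrow> (representative b0 t i a, representative b0 t j c) \<in> curve_isomorphism"
        using that representative_special ell by (simp add: pq eq_class)
      then show ?thesis using representatives_isomorphic_iff that by (simp add: pq)
    qed
    then show ?thesis by (rule card_image_eq_if_same_kernel)
  qed
  moreover have "?G ` ?I = {(i, y). i \<in> {0, 1, 2 :: nat} \<and> (\<exists>a. a^3 = y) \<and>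
      \<chi> (y - 27 * b0^i) \<noteq> 1 \<and> y \<noteq> 27 * b0^i}"
    (is "_ = ?D")
  proof (intro equalityI subsetI)
    fix p assume "p \<in> ?D"
    then obtain i a where "p = ?G (i, a)" "(i, a) \<in> ?I"
      by (auto simp: representative_indices_iff)
    then show "p \<in> ?G ` ?I" by blast
  qed (auto simp: representative_indices_iff)
  ultimately show ?thesis using card_index_pairs by simp
qed

end

end

theorem proposition11:
  fixes \<chi> :: "'a::{field,finite} \<Rightarrow> complex" and \<rho> :: complex and b0 t :: 'a
  assumes "CARD('a) mod 3 = 1"
    and "cubic_character \<chi>"
    and "\<rho> ^ 3 = 1" and "\<rho> \<noteq> 1"
    and "\<chi> b0 = \<rho>"
    and "\<nexists>s. s^2 = t"
  shows "real (card ((special_curves :: 'a weierstrass set) // curve_isomorphism))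
           = (2 * real CARD('a) + 4) / 3 \<and>
         (\<forall>(i, a) \<in> representative_indices \<chi> b0 t.
            representative b0 t i a \<in> special_curves) \<and>
         (\<forall>E \<in> special_curves. \<exists>(i, a) \<in> representative_indices \<chi> b0 t.
            (E, representative b0 t i a) \<in> curve_isomorphism) \<and>
         (\<forall>(i, a) \<in> representative_indices \<chi> b0 t. \<forall>(j, c) \<in> representative_indices \<chi> b0 t.
            (representative b0 t i a, representative b0 t j c) \<in> curve_isomorphism
              \<longleftrightarrow> i = j \<and> a^3 = c^3)"
proof -
  note hyps = assms(2-6)
  have "3 * real (card ((special_curves :: 'a weierstrass set) // curve_isomorphism))
      = 2 * real CARD('a) + 4"
    using arg_cong[OF card_special_curves_quotient[OF hyps], of real] by simp
  then have card: "real (card ((special_curves :: 'a weierstrass set) // curve_isomorphism))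
      = (2 * real CARD('a) + 4) / 3" by simp
  have "\<exists>(i, a) \<in> representative_indices \<chi> b0 t. (E, representative b0 t i a) \<in> curve_isomorphism"
    if "E \<in> special_curves" for E
    by (rule special_curve_isomorphic_representative[OF hyps that]) blast
  then show ?thesis
    using card representative_special[OF hyps] representatives_isomorphic_iff[OF hyps]
    by (intro conjI) blast+
qed

end
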